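(* Let $(v,p)$ be a smooth solution to the stationary Navier-Stokes equations $$(v\cdot\nabla)v=-\nabla p+\Delta v,\qquad \operatorname{div} v=0\qquad\text{on }\mathbb{R}^3,$$ let $Q=\frac12|v|^2+p$ and $\omega=\operatorname{curl} v$, and suppose that $$Q(x)\to 0\quad\text{as }|x|\to+\infty .$$ Set $M:=\sup_{x\in\mathbb{R}^3}|Q(x)|$. Then $$\int_{\mathbb{R}^3}\frac{|\nabla Q|^2}{|Q|}\left(\log\frac{eM}{|Q|}\right)^{-\alpha-1}dx\le\frac1\alpha\int_{\mathbb{R}^3}|\omega|^2dx\qquad\text{for all }\alpha>0 .$$ Moreover, if in addition $|v(x)|\to0$ as $|x|\to+\infty$ and $$\int_{\mathbb{R}^3}\frac{|\nabla Q|^2}{|Q|}\left(\log\frac{eM}{|Q|}\right)^{-\alpha-1}dx=o\left(\frac1\alpha\right)\qquad\text{as }\alpha\to0^+,$$ then $v=0$ on $\mathbb{R}^3$.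
   Context: Here $v:\mathbb{R}^3\to\mathbb{R}^3$ is the velocity, $p:\mathbb{R}^3\to\mathbb{R}$ the pressure, and $Q$ is called the head pressure. The integrals take values in $[0,+\infty]$. If $Q\equiv0$ (so that $M=0$), the integrand $\frac{|\nabla Q|^2}{|Q|}(\log\frac{eM}{|Q|})^{-\alpha-1}$ is interpreted as $0$. *)

theory Defs
  imports "HOL-Analysis.Analysis" "HOL-Library.Landau_Symbols"
begin

text \<open>\<open>C^k\<close> maps on the whole space: a map is \<open>C^(k+1)\<close> if it is differentiable everywhere
  and all its directional derivatives are \<open>C^k\<close>.\<close>

primrec C_k :: "nat \<Rightarrow> ('a::euclidean_space \<Rightarrow> 'b::euclidean_space) \<Rightarrow> bool" where
  "C_k 0 f \<longleftrightarrow> continuous_on UNIV f"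
| "C_k (Suc k) f \<longleftrightarrow>
     (\<forall>x. f differentiable (at x)) \<and> (\<forall>h. C_k k (\<lambda>x. frechet_derivative f (at x) h))"

definition smooth :: "('a::euclidean_space \<Rightarrow> 'b::euclidean_space) \<Rightarrow> bool" where
  "smooth f \<longleftrightarrow> (\<forall>k. C_k k f)"

definition pd :: "3 \<Rightarrow> (real^3 \<Rightarrow> real) \<Rightarrow> real^3 \<Rightarrow> real" where
  "pd i f x = frechet_derivative f (at x) (axis i 1)"

definition grad :: "(real^3 \<Rightarrow> real) \<Rightarrow> real^3 \<Rightarrow> real^3" where
  "grad f x = (\<chi> i. pd i f x)"

definition div_field :: "(real^3 \<Rightarrow> real^3) \<Rightarrow> real^3 \<Rightarrow> real" where
  "div_field v x = (\<Sum>i\<in>UNIV. pd i (\<lambda>y. v y $ i) x)"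

definition curl :: "(real^3 \<Rightarrow> real^3) \<Rightarrow> real^3 \<Rightarrow> real^3" where
  "curl v x = vector
     [pd 2 (\<lambda>y. v y $ 3) x - pd 3 (\<lambda>y. v y $ 2) x,
      pd 3 (\<lambda>y. v y $ 1) x - pd 1 (\<lambda>y. v y $ 3) x,
      pd 1 (\<lambda>y. v y $ 2) x - pd 2 (\<lambda>y. v y $ 1) x]"

definition laplacian :: "(real^3 \<Rightarrow> real^3) \<Rightarrow> real^3 \<Rightarrow> real^3" where
  "laplacian v x = (\<chi> j. \<Sum>i\<in>UNIV. pd i (pd i (\<lambda>y. v y $ j)) x)"

definition convection :: "(real^3 \<Rightarrow> real^3) \<Rightarrow> real^3 \<Rightarrow> real^3" where
  "convection v x = (\<chi> j. \<Sum>i\<in>UNIV. v x $ i * pd i (\<lambda>y. v y $ j) x)"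

definition smooth_stationary_NS :: "(real^3 \<Rightarrow> real^3) \<Rightarrow> (real^3 \<Rightarrow> real) \<Rightarrow> bool" where
  "smooth_stationary_NS v p \<longleftrightarrow>
     smooth v \<and> smooth p \<and>
     (\<forall>x. convection v x = - grad p x + laplacian v x) \<and>
     (\<forall>x. div_field v x = 0)"

definition head_pressure :: "(real^3 \<Rightarrow> real^3) \<Rightarrow> (real^3 \<Rightarrow> real) \<Rightarrow> real^3 \<Rightarrow> real" where
  "head_pressure v p x = 1/2 * (norm (v x))\<^sup>2 + p x"

text \<open>The integrand is \<open>0\<close> at any point where \<open>Q\<close> vanishes, since \<open>a / 0 = 0\<close>. This covers the
  convention for \<open>Q \<equiv> 0\<close>. If \<open>Q\<close> is not identically \<open>0\<close> but tends to \<open>0\<close> at infinity, then \<open>Q\<close>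
  has no zeros: \<open>\<Delta>Q - v \<cdot> \<nabla>Q = |\<omega>|^2 \<ge> 0\<close>, so \<open>Q < 0\<close> by the strong maximum principle.
  Where \<open>Q x \<noteq> 0\<close>, the logarithm is at least \<open>1\<close>.\<close>

definition weighted_integral :: "(real^3 \<Rightarrow> real) \<Rightarrow> real \<Rightarrow> ennreal" where
  "weighted_integral Q \<alpha> =
     (let M = (SUP x. \<bar>Q x\<bar>) in
      \<integral>\<^sup>+ x. ennreal ((norm (grad Q x))\<^sup>2 / \<bar>Q x\<bar> * ln (exp 1 * M / \<bar>Q x\<bar>) powr (- \<alpha> - 1)) \<partial>lborel)"

end

theory Submission
  imports Defs
begin

text \<open>The head pressure satisfies \<open>\<Delta>Q - v \<cdot> \<nabla>Q = |\<omega>|^2\<close>. For a \<open>C^1\<close> function \<open>\<phi>\<close> vanishing near 0 the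
  field \<open>\<phi>(Q) \<nabla>Q - \<Phi>(Q) v\<close> with \<open>\<Phi>' = \<phi>\<close> is compactly supported because \<open>Q \<rightarrow> 0\<close>, and the integral of
  its divergence gives \<open>\<integral> \<phi>(Q) |\<omega>|^2 = - \<integral> \<phi>'(Q) |\<nabla>Q|^2\<close>. If \<open>\<phi>\<close> is nonnegative, increasing and
  supported in the positive reals, both sides vanish, whence \<open>Q \<le> 0\<close>. Letting \<open>\<phi>(Q)\<close> increase to
  \<open>log(eM/|Q|)^(-\<alpha>)\<close> gives the exact identity \<open>\<alpha> W(\<alpha>) = \<integral> log(eM/|Q|)^(-\<alpha>) |\<omega>|^2\<close> for the weighted
  integral \<open>W\<close>, and the weight is at most 1. The right-hand side increases as \<open>\<alpha>\<close> decreases to 0, so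
  \<open>W(\<alpha>) = o(1/\<alpha>)\<close> forces \<open>\<omega> = 0\<close> where \<open>Q \<noteq> 0\<close>; on the interior of \<open>{Q = 0}\<close> the equation for \<open>Q\<close>
  gives \<open>\<omega> = 0\<close>, and continuity does the rest. Then each component of \<open>v\<close> is harmonic and tends to 0,
  and the energy identity without drift gives \<open>v = 0\<close>.\<close>

section \<open>Smooth functions and partial derivatives\<close>

lemma frechet_derivative_apply:
  "(f has_derivative f') (at x) \<Longrightarrow> frechet_derivative f (at x) h = f' h"
  by (simp flip: frechet_derivative_at)

lemma pd_has_derivative:
  assumes "(f has_derivative f') (at x)"
  shows "pd i f x = f' (axis i 1)"
  using frechet_derivative_at[OF assms] by (simp add: pd_def)

lemma differentiable_has_frechet_derivative:
  "f differentiable (at x) \<Longrightarrow> (f has_derivative frechet_derivative f (at x)) (at x)"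
  by (simp add: frechet_derivative_works)

lemma pd_add:
  assumes "f differentiable (at x)" "g differentiable (at x)"
  shows "pd i (\<lambda>y. f y + g y) x = pd i f x + pd i g x"
  using pd_has_derivative[OF has_derivative_add[OF assms[THEN differentiable_has_frechet_derivative]]]
  by (simp add: pd_def)

lemma pd_diff:
  assumes "f differentiable (at x)" "g differentiable (at x)"
  shows "pd i (\<lambda>y. f y - g y) x = pd i f x - pd i g x"
  using pd_has_derivative[OF has_derivative_diff[OF assms[THEN differentiable_has_frechet_derivative]]]
  by (simp add: pd_def)

lemma pd_minus:
  assumes "f differentiable (at x)"
  shows "pd i (\<lambda>y. - f y) x = - pd i f x"
  using pd_has_derivative[OF has_derivative_minus[OF assms[THEN differentiable_has_frechet_derivative]]]
  by (simp add: pd_def)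

lemma pd_mult:
  assumes "f differentiable (at x)" "g differentiable (at x)"
  shows "pd i (\<lambda>y. f y * g y) x = f x * pd i g x + pd i f x * g x"
  using pd_has_derivative[OF has_derivative_mult[OF assms[THEN differentiable_has_frechet_derivative]]]
  by (simp add: pd_def)

lemma pd_sum:
  assumes "\<And>j. j \<in> A \<Longrightarrow> f j differentiable (at x)"
  shows "pd i (\<lambda>y. \<Sum>j\<in>A. f j y) x = (\<Sum>j\<in>A. pd i (f j) x)"
  using pd_has_derivative[OF has_derivative_sum[of A f "\<lambda>j. frechet_derivative (f j) (at x)"]]
    differentiable_has_frechet_derivative[OF assms]
  by (simp add: pd_def)

lemma pd_const [simp]: "pd i (\<lambda>y. c) x = 0"
  by (simp add: pd_def)

lemma pd_compose:
  assumes "(\<phi> has_real_derivative d) (at (f x))" "f differentiable (at x)"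
  shows "pd i (\<lambda>y. \<phi> (f y)) x = d * pd i f x"
  using pd_has_derivative[OF has_derivative_compose[OF differentiable_has_frechet_derivative[OF assms(2)]
      assms(1)[unfolded has_field_derivative_def]]]
  by (simp add: pd_def)

text \<open>Restriction to lines parallel to an axis reduces partial derivatives to one real
  variable, where the mean value theorem and the constancy criterion are available.\<close>

lemma DERIV_along_line:
  assumes "\<And>x. f differentiable (at x)"
  shows "((\<lambda>t. f (x + t *\<^sub>R axis i 1)) has_real_derivative pd i f (x + t *\<^sub>R axis i 1)) (at t)"
proof -
  let ?e = "axis i (1::real) :: real^3"
  let ?D = "frechet_derivative f (at (x + t *\<^sub>R ?e))"
  have d: "(f has_derivative ?D) (at (x + t *\<^sub>R ?e))"
    using assms by (rule differentiable_has_frechet_derivative)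
  have "((\<lambda>t. x + t *\<^sub>R ?e) has_derivative (\<lambda>h. h *\<^sub>R ?e)) (at t)"
    by (auto intro!: derivative_eq_intros)
  from has_derivative_compose[OF this d]
  have "((\<lambda>t. f (x + t *\<^sub>R ?e)) has_derivative (\<lambda>h. ?D (h *\<^sub>R ?e))) (at t)" .
  moreover have "?D (h *\<^sub>R ?e) = pd i f (x + t *\<^sub>R ?e) * h" for h
    using linear_scale[OF has_derivative_linear[OF d]] by (simp add: pd_def)
  ultimately show ?thesis
    by (simp add: has_field_derivative_def)
qed

section \<open>Closure properties of \<open>C_k\<close> and of smooth maps\<close>

lemma C_k_mono: "C_k (Suc k) f \<Longrightarrow> C_k k f"
proof (induction k arbitrary: f)
  case 0
  then show ?case
    by (auto simp: continuous_on_eq_continuous_at intro!: differentiable_imp_continuous_within)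
next
  case (Suc k)
  from Suc.prems have "\<forall>x. f differentiable (at x)"
    "\<And>h. C_k (Suc k) (\<lambda>x. frechet_derivative f (at x) h)"
    by (simp_all only: C_k.simps) auto
  with Suc.IH show ?case by simp
qed

lemma C_k_const: "C_k k (\<lambda>x. c)"
  by (induction k arbitrary: c) auto

lemma C_k_compose_linear:
  fixes L :: "'b::euclidean_space \<Rightarrow> 'c::euclidean_space"
  assumes "bounded_linear L"
  shows "C_k k f \<Longrightarrow> C_k k (\<lambda>x. L (f x))"
proof (induction k arbitrary: f)
  case 0
  then show ?case
    using bounded_linear.continuous_on[OF assms] by auto
next
  case (Suc k)
  have "((\<lambda>x. L (f x)) has_derivative (\<lambda>h. L (frechet_derivative f (at x) h))) (at x)" for x
    using Suc.prems by (intro bounded_linear.has_derivative[OF assms] differentiable_has_frechet_derivative) auto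
  note D = this
  have "frechet_derivative (\<lambda>x. L (f x)) (at x) h = L (frechet_derivative f (at x) h)" for x h
    using D by (rule frechet_derivative_apply)
  moreover have "(\<lambda>x. L (f x)) differentiable (at x)" for x
    using D differentiable_def by blast
  ultimately show ?case using Suc by simp
qed

lemma C_k_add: "C_k k f \<Longrightarrow> C_k k g \<Longrightarrow> C_k k (\<lambda>x. f x + g x)"
proof (induction k arbitrary: f g)
  case 0
  then show ?case by (auto intro: continuous_intros)
next
  case (Suc k)
  have "((\<lambda>x. f x + g x) has_derivative
      (\<lambda>h. frechet_derivative f (at x) h + frechet_derivative g (at x) h)) (at x)" for x
    using Suc.prems by (intro has_derivative_add differentiable_has_frechet_derivative) auto
  then have "frechet_derivative (\<lambda>x. f x + g x) (at x) h =
      frechet_derivative f (at x) h + frechet_derivative g (at x) h" for x h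
    by (rule frechet_derivative_apply)
  with Suc show ?case by auto
qed

lemma C_k_mult:
  fixes f g :: "'a::euclidean_space \<Rightarrow> real"
  shows "C_k k f \<Longrightarrow> C_k k g \<Longrightarrow> C_k k (\<lambda>x. f x * g x)"
proof (induction k arbitrary: f g)
  case 0
  then show ?case by (auto intro: continuous_intros)
next
  case (Suc k)
  have "((\<lambda>x. f x * g x) has_derivative
      (\<lambda>h. f x * frechet_derivative g (at x) h + frechet_derivative f (at x) h * g x)) (at x)" for x
    using Suc.prems by (intro has_derivative_mult differentiable_has_frechet_derivative) auto
  then have "frechet_derivative (\<lambda>x. f x * g x) (at x) h =
      f x * frechet_derivative g (at x) h + frechet_derivative f (at x) h * g x" for x h
    by (rule frechet_derivative_apply)
  \<comment> \<open>The product rule leaves one factor undifferentiated, so the order of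
    \<open>f\<close> and \<open>g\<close> must be lowered from \<open>Suc k\<close> to
    \<open>k\<close>.\<close>
  moreover have "C_k k f" "C_k k g"
    using Suc.prems C_k_mono by blast+
  ultimately show ?case
    using Suc by (auto intro!: C_k_add)
qed

lemma smooth_const: "smooth (\<lambda>x. c)"
  by (simp add: smooth_def C_k_const)

lemma smooth_add: "smooth f \<Longrightarrow> smooth g \<Longrightarrow> smooth (\<lambda>x. f x + g x)"
  by (simp add: smooth_def C_k_add)

lemma smooth_mult:
  fixes f g :: "'a::euclidean_space \<Rightarrow> real"
  shows "smooth f \<Longrightarrow> smooth g \<Longrightarrow> smooth (\<lambda>x. f x * g x)"
  by (simp add: smooth_def C_k_mult)

lemma smooth_minus: "smooth f \<Longrightarrow> smooth (\<lambda>x. - f x)"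
  unfolding smooth_def using C_k_compose_linear[OF bounded_linear_minus[OF bounded_linear_ident]] by blast

lemma smooth_sum: "(\<And>j. j \<in> A \<Longrightarrow> smooth (f j)) \<Longrightarrow> smooth (\<lambda>x. \<Sum>j\<in>A. f j x)"
  by (induction A rule: infinite_finite_induct) (auto simp: smooth_const smooth_add)

lemma smooth_vec_nth: "smooth v \<Longrightarrow> smooth (\<lambda>x. v x $ j)"
  for v :: "'a::euclidean_space \<Rightarrow> real^'n"
  unfolding smooth_def using C_k_compose_linear[OF bounded_linear_vec_nth] by blast

lemma smooth_differentiable: "smooth f \<Longrightarrow> f differentiable (at x)"
  using C_k.simps(2)[of 0 f] by (auto simp: smooth_def)

lemma smooth_pd: "smooth f \<Longrightarrow> smooth (pd i f)"
proof -
  assume "smooth f"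
  then have "C_k k (\<lambda>x. frechet_derivative f (at x) (axis i 1))" for k
    using C_k.simps(2)[of k f] by (auto simp: smooth_def)
  then show "smooth (pd i f)"
    by (simp add: smooth_def pd_def[abs_def])
qed

lemma smooth_continuous_on: "smooth f \<Longrightarrow> continuous_on S f"
  using C_k.simps(1)[of f] by (auto simp: smooth_def intro: continuous_on_subset)

section \<open>Symmetry of second partial derivatives\<close>

text \<open>The mean value theorem is applied twice: first in direction \<open>i\<close> to the
  increment of \<open>f\<close> in direction \<open>j\<close>, then in direction \<open>j\<close> to
  the resulting increment of \<open>pd i f\<close>.\<close>

lemma second_difference_mvt:
  assumes "smooth f" "h > 0"
  shows "\<exists>s r. 0 < s \<and> s < h \<and> 0 < r \<and> r < h \<and>
    f (x + h *\<^sub>R axis i 1 + h *\<^sub>R axis j 1) - f (x + h *\<^sub>R axis i 1) - f (x + h *\<^sub>R axis j 1) + f x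
    = h\<^sup>2 * pd j (pd i f) (x + s *\<^sub>R axis i 1 + r *\<^sub>R axis j 1)"
proof -
  let ?a = "axis i (1::real) :: real^3" and ?b = "axis j (1::real) :: real^3"
  let ?g = "\<lambda>t. f ((x + h *\<^sub>R ?b) + t *\<^sub>R ?a) - f (x + t *\<^sub>R ?a)"
  have "(?g has_real_derivative
      pd i f ((x + h *\<^sub>R ?b) + t *\<^sub>R ?a) - pd i f (x + t *\<^sub>R ?a)) (at t)" for t
    by (intro DERIV_diff DERIV_along_line smooth_differentiable assms)
  from MVT2[OF \<open>h > 0\<close>, of ?g, OF this]
  obtain s where s: "0 < s" "s < h" and
    1: "?g h - ?g 0 = h * (pd i f ((x + h *\<^sub>R ?b) + s *\<^sub>R ?a) - pd i f (x + s *\<^sub>R ?a))"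
    by auto
  let ?k = "\<lambda>t. pd i f ((x + s *\<^sub>R ?a) + t *\<^sub>R ?b)"
  have "(?k has_real_derivative pd j (pd i f) ((x + s *\<^sub>R ?a) + t *\<^sub>R ?b)) (at t)" for t
    by (intro DERIV_along_line smooth_differentiable smooth_pd assms)
  from MVT2[OF \<open>h > 0\<close>, of ?k, OF this]
  obtain r where r: "0 < r" "r < h" and
    2: "?k h - ?k 0 = h * pd j (pd i f) ((x + s *\<^sub>R ?a) + r *\<^sub>R ?b)"
    by auto
  from 1 2 s r show ?thesis
    by (intro exI[of _ s] exI[of _ r]) (simp add: power2_eq_square algebra_simps)
qed

text \<open>The second difference is symmetric in the two directions, so the mixed derivatives agree
  at two nearby points. By continuity both values are within \<open>e\<close>, half the supposed
  gap, of the values at \<open>x\<close>, a contradiction.\<close>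

lemma pd_commute:
  assumes "smooth f"
  shows "pd j (pd i f) x = pd i (pd j f) x"
proof (rule ccontr)
  let ?a = "axis i (1::real) :: real^3" and ?b = "axis j (1::real) :: real^3"
  let ?A = "pd j (pd i f)" and ?B = "pd i (pd j f)"
  assume "?A x \<noteq> ?B x"
  define e where "e = \<bar>?A x - ?B x\<bar> / 2"
  then have "e > 0" using \<open>?A x \<noteq> ?B x\<close> by simp
  have "isCont ?A x" "isCont ?B x"
    using smooth_continuous_on[OF smooth_pd[OF smooth_pd[OF assms]], of UNIV]
    by (auto simp: continuous_on_eq_continuous_at)
  with \<open>e > 0\<close> obtain d1 d2 where d: "d1 > 0" "d2 > 0"
    and d1: "\<And>y. dist y x < d1 \<Longrightarrow> dist (?A y) (?A x) < e"
    and d2: "\<And>y. dist y x < d2 \<Longrightarrow> dist (?B y) (?B x) < e"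
    unfolding continuous_at_eps_delta by metis
  define h where "h = min d1 d2 / 2"
  have h: "h > 0" "2 * h \<le> d1" "2 * h \<le> d2" using d by (auto simp: h_def)
  have near: "dist (x + s *\<^sub>R axis k 1 + r *\<^sub>R axis l 1) x < 2 * h"
    if "0 < s" "s < h" "0 < r" "r < h" for s r and k l :: 3
  proof -
    have "norm (s *\<^sub>R axis k 1 + r *\<^sub>R axis l 1 :: real^3) \<le> s + r"
      using that norm_triangle_ineq[of "s *\<^sub>R axis k 1" "r *\<^sub>R axis l 1 :: real^3"] by simp
    then show ?thesis using that by (simp add: dist_norm add.assoc)
  qed
  obtain s r where A: "0 < s" "s < h" "0 < r" "r < h"
    "f (x + h *\<^sub>R ?a + h *\<^sub>R ?b) - f (x + h *\<^sub>R ?a) - f (x + h *\<^sub>R ?b) + f x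
    = h\<^sup>2 * ?A (x + s *\<^sub>R ?a + r *\<^sub>R ?b)"
    using second_difference_mvt[OF assms h(1), of x i j] by blast
  obtain s' r' where B: "0 < s'" "s' < h" "0 < r'" "r' < h"
    "f (x + h *\<^sub>R ?b + h *\<^sub>R ?a) - f (x + h *\<^sub>R ?b) - f (x + h *\<^sub>R ?a) + f x
    = h\<^sup>2 * ?B (x + s' *\<^sub>R ?b + r' *\<^sub>R ?a)"
    using second_difference_mvt[OF assms h(1), of x j i] by blast
  have "h\<^sup>2 * ?A (x + s *\<^sub>R ?a + r *\<^sub>R ?b) = h\<^sup>2 * ?B (x + s' *\<^sub>R ?b + r' *\<^sub>R ?a)"
    unfolding A(5)[symmetric] B(5)[symmetric] by (simp add: algebra_simps)
  then have "?A (x + s *\<^sub>R ?a + r *\<^sub>R ?b) = ?B (x + s' *\<^sub>R ?b + r' *\<^sub>R ?a)"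
    using h by simp
  moreover have "dist (?A (x + s *\<^sub>R ?a + r *\<^sub>R ?b)) (?A x) < e"
    using near[OF A(1-4)] h by (intro d1) (rule less_le_trans)
  moreover have "dist (?B (x + s' *\<^sub>R ?b + r' *\<^sub>R ?a)) (?B x) < e"
    using near[OF B(1-4)] h by (intro d2) (rule less_le_trans)
  ultimately show False
    unfolding dist_real_def e_def by (auto simp: abs_if split: if_splits)
qed

section \<open>Integration of compactly supported derivatives\<close>

lemma integrable_lborel_compact_support:
  fixes g :: "'a::euclidean_space \<Rightarrow> real"
  assumes "continuous_on UNIV g" "\<And>x. norm x > R \<Longrightarrow> g x = 0"
  shows "integrable lborel g"
proof -
  have "integrable lborel (\<lambda>x. indicator (cball 0 R) x *\<^sub>R g x)"
    using assms(1) by (intro borel_integrable_compact) (auto intro: continuous_on_subset)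
  moreover have "(\<lambda>x. indicator (cball 0 R) x *\<^sub>R g x) = g"
    using assms(2) by (auto simp: indicator_def fun_eq_iff)
  ultimately show ?thesis by simp
qed

lemma lborel_integral_translate:
  fixes f :: "'a::euclidean_space \<Rightarrow> real"
  assumes [measurable]: "f \<in> borel_measurable borel"
  shows "(\<integral>x. f (x + c) \<partial>lborel) = (\<integral>x. f x \<partial>lborel)"
proof -
  have "(\<integral>x. f x \<partial>lborel) = (\<integral>x. f x \<partial>distr lborel borel ((+) c))"
    by (simp add: lborel_distr_plus)
  also have "\<dots> = (\<integral>x. f (c + x) \<partial>lborel)"
    by (rule integral_distr) simp_all
  finally show ?thesis by (simp add: add.commute)
qed

lemma pd_zero_on_open:
  assumes "open S" "\<And>y. y \<in> S \<Longrightarrow> F y = 0" "x \<in> S"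
  shows "pd i F x = 0"
proof -
  have "((\<lambda>x. 0) has_derivative (\<lambda>h. 0 :: real)) (at x)" by simp
  then have "(F has_derivative (\<lambda>h. 0)) (at x)"
    by (rule has_derivative_transform_within_open[OF _ assms(1,3)]) (simp add: assms(2))
  then show ?thesis by (simp add: pd_has_derivative)
qed

lemma pd_zero_outside:
  assumes "\<And>x. norm x > R \<Longrightarrow> F x = 0" "norm x > R"
  shows "pd i F x = 0"
proof (rule pd_zero_on_open)
  show "open {x::real^3. norm x > R}"
    by (intro open_Collect_less continuous_intros)
qed (use assms in auto)

text \<open>Translation invariance makes every difference quotient of \<open>F\<close> integrate to
  0, and dominated convergence passes this to the derivative. No Fubini argument is
  involved.\<close>

lemma integral_pd_compact_support:
  assumes diff: "\<And>x. F differentiable (at x)"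
    and cont: "continuous_on UNIV (pd i F)"
    and zero: "\<And>x. norm x > R \<Longrightarrow> F x = 0"
  shows "(\<integral>x. pd i F x \<partial>lborel) = 0"
proof -
  let ?e = "axis i (1::real) :: real^3"
  define h where "h n = 1 / real (Suc n)" for n
  have h: "0 < h n" "h n \<le> 1" for n by (auto simp: h_def)
  have contF: "continuous_on UNIV F"
    using diff by (auto simp: continuous_on_eq_continuous_at intro!: differentiable_imp_continuous_within)
  then have [measurable]: "F \<in> borel_measurable borel"
    by (rule borel_measurable_continuous_onI)
  have [measurable]: "pd i F \<in> borel_measurable borel"
    using cont by (rule borel_measurable_continuous_onI)
  have intF: "integrable lborel F"
    by (rule integrable_lborel_compact_support[OF contF zero])
  have contT: "continuous_on UNIV (\<lambda>x. F (x + c))" for c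
    by (rule continuous_on_compose2[OF contF]) (auto intro!: continuous_intros)
  have intT: "integrable lborel (\<lambda>x. F (x + h n *\<^sub>R ?e))" for n
  proof (rule integrable_lborel_compact_support[OF contT])
    fix x :: "real^3" assume "norm x > R + 1"
    then show "F (x + h n *\<^sub>R ?e) = 0"
      using norm_diff_ineq[of x "h n *\<^sub>R ?e"] h[of n] by (intro zero) simp
  qed
  obtain C where C: "\<And>x. \<bar>pd i F x\<bar> \<le> C" "0 \<le> C"
  proof -
    have "bounded (pd i F ` cball 0 R)"
      using cont by (intro compact_imp_bounded compact_continuous_image) (auto intro: continuous_on_subset)
    then obtain C where C: "0 < C" "\<forall>y\<in>pd i F ` cball 0 R. norm y \<le> C"
      unfolding bounded_pos by blast
    have "\<bar>pd i F x\<bar> \<le> C" for x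
      using C pd_zero_outside[of R F x i] zero by (cases "norm x \<le> R") auto
    with C(1) show ?thesis by (intro that[of C]) auto
  qed
  define s where "s n x = (F (x + h n *\<^sub>R ?e) - F x) / h n" for n x
  have "(\<lambda>n. \<integral>x. s n x \<partial>lborel) \<longlonglongrightarrow> (\<integral>x. pd i F x \<partial>lborel)"
  \<comment> \<open>By the mean value theorem each quotient is a value of \<open>pd i F\<close>,
    hence at most \<open>C\<close>. The shift \<open>h n\<close> is at most 1, so all quotients
    vanish outside the ball of radius \<open>R + 1\<close>.\<close>
  proof (rule integral_dominated_convergence[where w = "\<lambda>x. C * indicator (cball 0 (R + 1)) x"])
    show "integrable lborel (\<lambda>x::real^3. C * indicator (cball 0 (R + 1)) x)"
      by (intro integrable_mult_right integrable_real_indicator) (use emeasure_lborel_cball_finite in \<open>auto simp: less_top\<close>)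
    show "AE x in lborel. (\<lambda>n. s n x) \<longlonglongrightarrow> pd i F x"
    proof (rule AE_I2)
      fix x
      have "((\<lambda>t. F (x + t *\<^sub>R ?e)) has_real_derivative pd i F x) (at 0)"
        using DERIV_along_line[OF diff, where t = 0] by simp
      then have "((\<lambda>t. (F (x + t *\<^sub>R ?e) - F x) / t) \<longlongrightarrow> pd i F x) (at 0)"
        by (simp add: DERIV_def)
      moreover have "filterlim h (at 0) sequentially"
        unfolding filterlim_at h_def[abs_def] using LIMSEQ_inverse_real_of_nat
        by (auto simp: inverse_eq_divide)
      ultimately show "(\<lambda>n. s n x) \<longlonglongrightarrow> pd i F x"
        unfolding s_def by (rule filterlim_compose)
    qed
    show "AE x in lborel. norm (s n x) \<le> C * indicator (cball 0 (R + 1)) x" for n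
    proof (rule AE_I2)
      fix x
      obtain z where z: "0 < z" "z < h n"
        "F (x + h n *\<^sub>R ?e) - F (x + 0 *\<^sub>R ?e) = (h n - 0) * pd i F (x + z *\<^sub>R ?e)"
        using MVT2[OF h(1)[of n], of "\<lambda>t. F (x + t *\<^sub>R ?e)" "\<lambda>t. pd i F (x + t *\<^sub>R ?e)"]
          DERIV_along_line[OF diff] by blast
      then have s: "s n x = pd i F (x + z *\<^sub>R ?e)"
        using h[of n] by (simp add: s_def)
      show "norm (s n x) \<le> C * indicator (cball 0 (R + 1)) x"
      proof (cases "norm x \<le> R + 1")
        case True
        then show ?thesis using s C by simp
      next
        case False
        then have "norm (x + z *\<^sub>R ?e) > R"
          using norm_diff_ineq[of x "z *\<^sub>R ?e"] z h[of n] by simp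
        then show ?thesis using s pd_zero_outside[of R F] zero C by simp
      qed
    qed
  qed (auto simp: s_def)
  moreover have "(\<integral>x. s n x \<partial>lborel) = 0" for n
    unfolding s_def using lborel_integral_translate[of F "h n *\<^sub>R ?e"] intT intF by simp
  ultimately show ?thesis
    by (simp add: LIMSEQ_const_iff)
qed

section \<open>The energy identity\<close>

text \<open>Replacing \<open>f\<close> by a constant to the left of \<open>d\<close> causes no kink
  because the slope at \<open>d\<close> is 0. This supplies the derivatives of the truncated test
  functions used below.\<close>

lemma DERIV_max_const:
  fixes f :: "real \<Rightarrow> real"
  assumes deriv: "\<And>l. l \<ge> d \<Longrightarrow> (f has_real_derivative f' l) (at l)" and "f' d = 0"
  shows "((\<lambda>l. f (max d l)) has_real_derivative f' (max d l)) (at l)"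
proof -
  consider "l < d" | "l > d" | "l = d" by linarith
  then show ?thesis
  proof cases
    case 1
    have "((\<lambda>l. f d) has_real_derivative 0) (at l)" by simp
    then have "((\<lambda>l. f (max d l)) has_real_derivative 0) (at l)"
      by (rule has_field_derivative_transform_within_open[where S = "{..<d}"]) (use 1 in auto)
    with 1 assms(2) show ?thesis by simp
  next
    case 2
    then have "(f has_real_derivative f' l) (at l)" by (intro deriv) simp
    then have "((\<lambda>l. f (max d l)) has_real_derivative f' l) (at l)"
      by (rule has_field_derivative_transform_within_open[where S = "{d<..}"]) (use 2 in auto)
    with 2 show ?thesis by simp
  next
    case 3
    have "((\<lambda>y. (f y - f d) / (y - d)) \<longlongrightarrow> 0) (at d)"
      using deriv[of d] assms(2) by (simp add: has_field_derivative_iff)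
    then have "((\<lambda>y. (f y - f d) / (y - d)) \<longlongrightarrow> 0) (at_right d)"
      by (rule tendsto_mono[OF at_le, rotated]) simp
    then have "((\<lambda>y. (f (max d y) - f (max d d)) / (y - d)) \<longlongrightarrow> 0) (at_right d)"
      by (rule Lim_transform_eventually) (auto simp: eventually_at_right_less intro!: eventually_mono[OF eventually_at_right_less])
    moreover have "((\<lambda>y. (f (max d y) - f (max d d)) / (y - d)) \<longlongrightarrow> 0) (at_left d)"
      by (rule Lim_transform_eventually[OF tendsto_const])
        (auto simp: eventually_at_left_field intro!: exI[of _ "d - 1"])
    ultimately have "((\<lambda>y. (f (max d y) - f (max d d)) / (y - d)) \<longlongrightarrow> 0) (at d)"
      by (rule filterlim_split_at[rotated])
    with 3 assms(2) show ?thesis by (simp add: has_field_derivative_iff)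
  qed
qed

lemma continuous_on_compose_isCont:
  fixes \<phi> :: "real \<Rightarrow> real" and u :: "'a::euclidean_space \<Rightarrow> real"
  assumes "continuous_on UNIV u" "\<And>x. isCont \<phi> (u x)"
  shows "continuous_on UNIV (\<lambda>x. \<phi> (u x))"
  using assms by (auto simp: continuous_on_eq_continuous_at intro: isCont_o2)

lemma norm_grad_squared: "(norm (grad u x))\<^sup>2 = (\<Sum>i\<in>UNIV. pd i u x * pd i u x)"
  by (simp add: power2_norm_eq_inner inner_vec_def grad_def)

text \<open>The extended bounds \<open>a\<close> and \<open>c\<close> confine the hypotheses on
  \<phi> to an open interval containing all values of \<open>u\<close>. The maximum principle uses
  the whole line; the logarithmic weight uses an interval at whose lower end it blows up.\<close>

lemma energy_identity:
  fixes a c :: ereal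
  assumes u: "smooth u" and b: "smooth b" and div_free: "\<And>x. div_field b x = 0"
    and eq: "\<And>x. (\<Sum>i\<in>UNIV. pd i (pd i u) x) - (\<Sum>i\<in>UNIV. b x $ i * pd i u x) = w x"
    and lim: "(u \<longlongrightarrow> 0) at_infinity"
    and range: "\<And>x. a < ereal (u x)" "\<And>x. ereal (u x) < c" and "a < 0" "0 < c"
    and deriv: "\<And>s. a < ereal s \<Longrightarrow> ereal s < c \<Longrightarrow> (\<phi> has_real_derivative \<phi>' s) (at s)"
    and contd: "\<And>s. a < ereal s \<Longrightarrow> ereal s < c \<Longrightarrow> isCont \<phi>' s"
    and "e > 0" and zero: "\<And>s. \<bar>s\<bar> < e \<Longrightarrow> \<phi> s = 0"
  shows "integrable lborel (\<lambda>x. \<phi>' (u x) * (norm (grad u x))\<^sup>2)"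
    and "integrable lborel (\<lambda>x. \<phi> (u x) * w x)"
    and "(\<integral>x. \<phi> (u x) * w x \<partial>lborel) = - (\<integral>x. \<phi>' (u x) * (norm (grad u x))\<^sup>2 \<partial>lborel)"
proof -
  have cont_phi: "isCont \<phi> s" if "a < ereal s" "ereal s < c" for s
    using deriv[OF that] by (rule DERIV_isCont)
  have "a < c" using \<open>a < 0\<close> \<open>0 < c\<close> by (rule less_trans)
  from einterval_antiderivative[OF this cont_phi]
  obtain \<Psi> where \<Psi>: "\<And>s. a < ereal s \<Longrightarrow> ereal s < c \<Longrightarrow> (\<Psi> has_vector_derivative \<phi> s) (at s)"
    by blast
  \<comment> \<open>Normalising at 0 makes \<Phi> vanish at all values of \<open>u\<close> below
    \<open>e\<close> in modulus, just as \<phi> does. This gives the field \<open>F\<close> compact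
    support.\<close>
  define \<Phi> where "\<Phi> s = \<Psi> s - \<Psi> 0" for s
  have \<Phi>: "(\<Phi> has_real_derivative \<phi> s) (at s)" if "a < ereal s" "ereal s < c" for s
    using \<Psi>[OF that] unfolding \<Phi>_def has_real_derivative_iff_has_vector_derivative
    by (auto intro!: derivative_eq_intros)
  have zero_d: "\<phi>' (u x) = 0" if "\<bar>u x\<bar> < e" for x
  proof -
    have "((\<lambda>s. 0) has_real_derivative 0) (at (u x))" by simp
    moreover have "open {-e<..<e}" by simp
    ultimately have "(\<phi> has_real_derivative 0) (at (u x))"
      by (rule has_field_derivative_transform_within_open) (use that zero in auto)
    with deriv[OF range] show ?thesis by (rule DERIV_unique)
  qed
  have zero_\<Phi>: "\<Phi> (u x) = 0" if "\<bar>u x\<bar> < e" for x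
  proof -
    \<comment> \<open>The derivative of \<Phi> is known only between \<open>a\<close> and
      \<open>c\<close>. The segment from 0 to \<open>u x\<close> stays there since both endpoints
      do, and \<phi> vanishes along it.\<close>
    have seg: "\<bar>s\<bar> < e \<and> a < ereal s \<and> ereal s < c" if "s \<in> closed_segment 0 (u x)" for s
    proof (cases "0 \<le> u x")
      case True
      then have "0 \<le> s" "s \<le> u x" using that by (auto simp: closed_segment_eq_real_ivl)
      moreover from this have "0 \<le> ereal s" "ereal s \<le> ereal (u x)" by simp_all
      then have "a < ereal s" "ereal s < c"
        using \<open>a < 0\<close> range[of x] less_le_trans le_less_trans by blast+
      ultimately show ?thesis using \<open>\<bar>u x\<bar> < e\<close> by auto
    next
      case False
      then have "s \<le> 0" "u x \<le> s" using that by (auto simp: closed_segment_eq_real_ivl split: if_splits)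
      moreover from this have "ereal s \<le> 0" "ereal (u x) \<le> ereal s" by simp_all
      then have "a < ereal s" "ereal s < c"
        using \<open>0 < c\<close> range[of x] less_le_trans le_less_trans by blast+
      ultimately show ?thesis using \<open>\<bar>u x\<bar> < e\<close> by auto
    qed
    have "\<exists>k. \<forall>s\<in>closed_segment 0 (u x). \<Phi> s = k"
    proof (rule has_field_derivative_zero_constant)
      show "(\<Phi> has_field_derivative 0) (at s within closed_segment 0 (u x))"
        if "s \<in> closed_segment 0 (u x)" for s
        using \<Phi>[of s] seg[OF that] zero[of s] by (auto intro: has_field_derivative_at_within)
    qed simp
    then have "\<Phi> (u x) = \<Phi> 0" by (metis ends_in_segment)
    then show ?thesis by (simp add: \<Phi>_def)
  qed
  have "eventually (\<lambda>x. dist (u x) 0 < e) at_infinity"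
    using lim \<open>e > 0\<close> by (rule tendstoD)
  then obtain R where "\<And>x. norm x \<ge> R \<Longrightarrow> \<bar>u x\<bar> < e"
    by (auto simp: eventually_at_infinity)
  then have R: "\<bar>u x\<bar> < e" if "norm x > R" for x using that by simp

  have comp: "(\<lambda>y. f (u y)) differentiable (at x)"
    if "(f has_real_derivative d) (at (u x))" for f d x
    using differentiable_compose[OF differentiableI[OF that[unfolded has_field_derivative_def]]
        smooth_differentiable[OF u]] .
  have du: "(pd i u) differentiable (at x)" for i x
    by (intro smooth_differentiable smooth_pd u)
  have db: "(\<lambda>y. b y $ i) differentiable (at x)" for i x
    by (intro smooth_differentiable smooth_vec_nth b)
  define F where "F i x = \<phi> (u x) * pd i u x - b x $ i * \<Phi> (u x)" for i x
  have dF: "F i differentiable (at x)" for i x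
    unfolding F_def[abs_def]
    by (intro differentiable_diff differentiable_mult du db comp[OF deriv[OF range]] comp[OF \<Phi>[OF range]])
  have pdF: "pd i (F i) x = \<phi> (u x) * pd i (pd i u) x + \<phi>' (u x) * (pd i u x * pd i u x)
      - (b x $ i * (\<phi> (u x) * pd i u x) + pd i (\<lambda>y. b y $ i) x * \<Phi> (u x))" for i x
  proof -
    have c1: "(\<lambda>y. \<phi> (u y)) differentiable (at x)" "(\<lambda>y. \<Phi> (u y)) differentiable (at x)"
      by (rule comp[OF deriv[OF range]], rule comp[OF \<Phi>[OF range]])
    have "pd i (F i) x = pd i (\<lambda>y. \<phi> (u y) * pd i u y) x - pd i (\<lambda>y. b y $ i * \<Phi> (u y)) x"
      unfolding F_def[abs_def] by (rule pd_diff) (rule differentiable_mult c1 du db)+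
    also have "pd i (\<lambda>y. \<phi> (u y) * pd i u y) x
        = \<phi> (u x) * pd i (pd i u) x + \<phi>' (u x) * (pd i u x * pd i u x)"
      using pd_mult[OF c1(1) du] pd_compose[OF deriv[OF range] smooth_differentiable[OF u]] by simp
    also have "pd i (\<lambda>y. b y $ i * \<Phi> (u y)) x
        = b x $ i * (\<phi> (u x) * pd i u x) + pd i (\<lambda>y. b y $ i) x * \<Phi> (u x)"
      using pd_mult[OF db c1(2)] pd_compose[OF \<Phi>[OF range] smooth_differentiable[OF u]] by simp
    finally show ?thesis .
  qed
  note [continuous_intros] = continuous_on_compose_isCont[OF smooth_continuous_on[OF u]]
  have isC: "isCont \<phi> (u x)" "isCont \<phi>' (u x)" "isCont \<Phi> (u x)" for x
    using range by (auto intro: cont_phi contd DERIV_isCont[OF \<Phi>])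
  have cu: "continuous_on UNIV (pd i u)" "continuous_on UNIV (pd i (pd i u))"
    "continuous_on UNIV (\<lambda>y. b y $ i)" "continuous_on UNIV (pd i (\<lambda>y. b y $ i))" for i
    by (intro smooth_continuous_on smooth_pd smooth_vec_nth u b)+
  have cF: "continuous_on UNIV (pd i (F i))" for i
    unfolding pdF by (intro continuous_intros isC cu)
  have zF: "F i x = 0" if "norm x > R" for i x
    using zero[OF R[OF that]] zero_\<Phi>[OF R[OF that]] by (simp add: F_def)
  have intF: "integrable lborel (pd i (F i))" for i
    using cF pd_zero_outside[of R "F i", OF zF] by (rule integrable_lborel_compact_support)
  show int1: "integrable lborel (\<lambda>x. \<phi>' (u x) * (norm (grad u x))\<^sup>2)"
  proof (rule integrable_lborel_compact_support[of _ R])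
    show "continuous_on UNIV (\<lambda>x. \<phi>' (u x) * (norm (grad u x))\<^sup>2)"
      unfolding norm_grad_squared by (intro continuous_intros isC cu)
  qed (simp add: zero_d[OF R])
  show int2: "integrable lborel (\<lambda>x. \<phi> (u x) * w x)"
  proof (rule integrable_lborel_compact_support[of _ R])
    show "continuous_on UNIV (\<lambda>x. \<phi> (u x) * w x)"
      unfolding eq[symmetric] by (intro continuous_intros isC cu)
  qed (simp add: zero[OF R])
  have "(\<Sum>i\<in>UNIV. pd i (F i) x) = \<phi> (u x) * w x + \<phi>' (u x) * (norm (grad u x))\<^sup>2" for x
  proof -
    \<comment> \<open>The terms with a factor \<phi> assemble into the left side of the equation for
      \<open>u\<close>; the terms with \<Phi> carry the divergence of \<open>b\<close>, which is
      0.\<close>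
    have "(\<Sum>i\<in>UNIV. pd i (F i) x) =
      \<phi> (u x) * ((\<Sum>i\<in>UNIV. pd i (pd i u) x) - (\<Sum>i\<in>UNIV. b x $ i * pd i u x))
      + \<phi>' (u x) * (norm (grad u x))\<^sup>2 - \<Phi> (u x) * div_field b x"
      unfolding pdF norm_grad_squared div_field_def
      by (simp add: sum.distrib sum_subtractf sum_distrib_left algebra_simps)
    then show ?thesis by (simp add: eq div_free)
  qed
  then have "(\<integral>x. \<phi> (u x) * w x + \<phi>' (u x) * (norm (grad u x))\<^sup>2 \<partial>lborel)
      = (\<integral>x. (\<Sum>i\<in>UNIV. pd i (F i) x) \<partial>lborel)" by simp
  also have "\<dots> = (\<Sum>i\<in>UNIV. \<integral>x. pd i (F i) x \<partial>lborel)"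
    using intF by (rule Bochner_Integration.integral_sum)
  also have "\<dots> = 0"
    by (intro sum.neutral ballI integral_pd_compact_support[OF dF cF zF])
  finally show "(\<integral>x. \<phi> (u x) * w x \<partial>lborel) = - (\<integral>x. \<phi>' (u x) * (norm (grad u x))\<^sup>2 \<partial>lborel)"
    using int1 int2 by simp
qed

section \<open>The weak maximum principle\<close>

text \<open>A nonempty open set has positive measure. Applied to the set where a continuous function
  is nonzero, this turns vanishing almost everywhere into vanishing everywhere.\<close>

lemma open_AE_notin_imp_empty:
  fixes S :: "'a::euclidean_space set"
  assumes "open S" "AE x in lborel. x \<notin> S"
  shows "S = {}"
proof -
  have "S \<in> null_sets lborel"
    using assms by (subst AE_iff_null_sets) auto
  then have "negligible S"
    by (simp add: negligible_iff_null_sets null_sets_completionI)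
  with assms(1) show ?thesis using open_not_negligible by blast
qed

text \<open>With a nonnegative increasing test function supported in the positive reals, the two
  sides of the energy identity have opposite signs, so both are 0. Then \<phi> of \<open>u\<close>
  is constant along a line on which it vanishes far out.\<close>

lemma subsolution_nonpos:
  assumes u: "smooth u" and b: "smooth b" and div_free: "\<And>x. div_field b x = 0"
    and eq: "\<And>x. (\<Sum>i\<in>UNIV. pd i (pd i u) x) - (\<Sum>i\<in>UNIV. b x $ i * pd i u x) = w x"
    and w: "\<And>x. 0 \<le> w x"
    and lim: "(u \<longlongrightarrow> 0) at_infinity"
  shows "u x \<le> 0"
proof (rule ccontr)
  assume "\<not> u x \<le> 0"
  \<comment> \<open>Half the supposed positive value keeps \<phi> zero near 0 while \<phi> at
    \<open>u x\<close> is positive.\<close>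
  define e where "e = u x / 2"
  have e: "e > 0" "u x = 2 * e" using \<open>\<not> u x \<le> 0\<close> by (auto simp: e_def)
  define \<phi> where "\<phi> s = (max e s - e)\<^sup>2" for s :: real
  define \<phi>' where "\<phi>' s = 2 * (max e s - e)" for s :: real
  have deriv: "(\<phi> has_real_derivative \<phi>' s) (at s)" for s
    unfolding \<phi>_def \<phi>'_def
    by (rule DERIV_max_const[where f = "\<lambda>m. (m - e)\<^sup>2" and f' = "\<lambda>m. 2 * (m - e)"])
      (auto intro!: derivative_eq_intros)
  have contd: "isCont \<phi>' s" for s
    unfolding \<phi>'_def by (intro continuous_intros)
  have zero: "\<phi> s = 0" if "\<bar>s\<bar> < e" for s
    using that by (simp add: \<phi>_def)
  note E = energy_identity[OF u b div_free eq lim, of "-\<infinity>" \<infinity>, OF _ _ _ _ deriv contd e(1) zero]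
  let ?g = "\<lambda>x. \<phi>' (u x) * (norm (grad u x))\<^sup>2"
  have int: "integrable lborel ?g"
    by (rule E(1)) simp_all
  have "(\<integral>x. \<phi> (u x) * w x \<partial>lborel) = - (\<integral>x. ?g x \<partial>lborel)"
    by (rule E(3)) simp_all
  moreover have "0 \<le> (\<integral>x. \<phi> (u x) * w x \<partial>lborel)"
    using w by (intro integral_nonneg_AE) (auto simp: \<phi>_def)
  moreover have "0 \<le> (\<integral>x. ?g x \<partial>lborel)"
    by (intro integral_nonneg_AE) (auto simp: \<phi>'_def)
  ultimately have "(\<integral>x. ?g x \<partial>lborel) = 0" by simp
  moreover have "AE x in lborel. 0 \<le> ?g x"
    by (intro AE_I2) (simp add: \<phi>'_def)
  ultimately have AE0: "AE x in lborel. ?g x = 0"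
    using integral_nonneg_eq_0_iff_AE[OF int] by blast
  have "continuous_on UNIV ?g"
    unfolding norm_grad_squared
    by (intro continuous_intros continuous_on_compose_isCont[OF smooth_continuous_on[OF u] contd]
        smooth_continuous_on[OF smooth_pd[OF u]])
  then have "open {x. ?g x \<noteq> 0}"
    by (intro open_Collect_neq continuous_on_const)
  then have "{x. ?g x \<noteq> 0} = {}"
    using AE0 by (intro open_AE_notin_imp_empty) auto
  then have g0: "?g y = 0" for y by blast
  \<comment> \<open>A single direction suffices: this product is the derivative of \<phi> of
    \<open>u\<close> along the first axis.\<close>
  have "\<phi>' (u y) * pd 1 u y = 0" for y
  proof (cases "\<phi>' (u y) = 0")
    case False
    then have "grad u y = 0" using g0[of y] by simp
    then have "grad u y $ 1 = 0" by simp
    then show ?thesis by (simp add: grad_def)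
  qed simp
  then have pd0: "pd 1 (\<lambda>y. \<phi> (u y)) y = 0" for y
    by (simp add: pd_compose[OF deriv smooth_differentiable[OF u]])
  have "(\<lambda>y. \<phi> (u y)) differentiable (at y)" for y
    using differentiable_compose[OF differentiableI[OF deriv[unfolded has_field_derivative_def]]
        smooth_differentiable[OF u]] .
  note D = DERIV_along_line[of "\<lambda>y. \<phi> (u y)", OF this, of x 1, unfolded pd0]
  have const: "\<phi> (u (x + t *\<^sub>R axis 1 1)) = \<phi> (u x)" for t
    using DERIV_isconst_all[of "\<lambda>t. \<phi> (u (x + t *\<^sub>R axis 1 1))" t 0] D by simp
  have "eventually (\<lambda>x. dist (u x) 0 < e) at_infinity"
    using lim e(1) by (rule tendstoD)
  then obtain R where R: "\<And>x. norm x \<ge> R \<Longrightarrow> \<bar>u x\<bar> < e"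
    by (auto simp: eventually_at_infinity)
  \<comment> \<open>This point of the line through \<open>x\<close> lies far enough out that
    \<open>u\<close> is below \<open>e\<close> in modulus there, so \<phi> of \<open>u\<close> is
    0.\<close>
  have "norm (x + (\<bar>R\<bar> + norm x) *\<^sub>R axis 1 1) \<ge> R"
    using norm_diff_ineq[of "(\<bar>R\<bar> + norm x) *\<^sub>R axis 1 1" x] by (simp add: add.commute)
  from zero[OF R[OF this]] const have "\<phi> (u x) = 0" by metis
  then show False using e by (simp add: \<phi>_def)
qed

section \<open>The equation for the head pressure\<close>

text \<open>Expanding the three components gives the squared norm of the Jacobian minus the trace of
  its square, the form in which the source term arises for the head pressure.\<close>

lemma norm_curl_squared:
  "(norm (curl v x))\<^sup>2 =
    (\<Sum>i\<in>UNIV. \<Sum>j\<in>UNIV. (pd i (\<lambda>y. v y $ j) x)\<^sup>2 - pd j (\<lambda>y. v y $ i) x * pd i (\<lambda>y. v y $ j) x)"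
  unfolding curl_def power2_norm_eq_inner inner_vec_def
  by (simp add: sum_3 power2_eq_square algebra_simps)

lemma smooth_head_pressure:
  assumes "smooth v" "smooth p"
  shows "smooth (head_pressure v p)"
proof -
  have "head_pressure v p = (\<lambda>x. 1/2 * (\<Sum>j\<in>UNIV. v x $ j * v x $ j) + p x)"
    by (simp add: fun_eq_iff head_pressure_def power2_norm_eq_inner inner_vec_def)
  then show ?thesis
    by (simp only:) (intro smooth_add smooth_mult smooth_const smooth_sum smooth_vec_nth assms)
qed

text \<open>The divergence of the momentum equation gives the Laplacian of \<open>p\<close> as minus
  the trace of the squared Jacobian. The momentum equation paired with \<open>v\<close> reduces the
  drift term to the product of \<open>v\<close> with its Laplacian, which cancels against the same
  term in the Laplacian of half the squared speed.\<close>

lemma head_pressure_equation: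
  assumes NS: "smooth_stationary_NS v p"
  defines "Q \<equiv> head_pressure v p"
  shows "(\<Sum>i\<in>UNIV. pd i (pd i Q) x) - (\<Sum>i\<in>UNIV. v x $ i * pd i Q x) = (norm (curl v x))\<^sup>2"
proof -
  define V where "V j = (\<lambda>y. v y $ j)" for j
  have v: "smooth v" and p: "smooth p" using NS by (auto simp: smooth_stationary_NS_def)
  have V: "smooth (V j)" for j unfolding V_def by (rule smooth_vec_nth[OF v])
  note sm = V p smooth_pd[OF V] smooth_pd[OF p] smooth_pd[OF smooth_pd[OF V]]
    smooth_pd[OF smooth_pd[OF smooth_pd[OF V]]]
  note df = sm[THEN smooth_differentiable]
  have momentum: "pd j p x = (\<Sum>i\<in>UNIV. pd i (pd i (V j)) x) - (\<Sum>i\<in>UNIV. V i x * pd i (V j) x)" for j x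
  proof -
    have "convection v x $ j = (- grad p x + laplacian v x) $ j"
      using NS by (simp add: smooth_stationary_NS_def)
    then show ?thesis by (simp add: convection_def grad_def laplacian_def V_def)
  qed
  have div0: "(\<Sum>i\<in>UNIV. pd i (V i) x) = 0" for x
    using NS by (simp add: smooth_stationary_NS_def div_field_def V_def)
  have div1: "(\<Sum>i\<in>UNIV. pd k (pd i (V i)) x) = 0" for k x
    using pd_sum[of UNIV "\<lambda>i. pd i (V i)" x k] df by (simp add: div0)
  have div2: "(\<Sum>i\<in>UNIV. pd k (pd k (pd i (V i))) x) = 0" for k x
    using pd_sum[of UNIV "\<lambda>i. pd k (pd i (V i))" x k] df by (simp add: div1)
  have Q: "Q = (\<lambda>x. 1/2 * (\<Sum>j\<in>UNIV. V j x * V j x) + p x)"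
    by (simp add: fun_eq_iff Q_def head_pressure_def power2_norm_eq_inner inner_vec_def V_def)
  have pdQ: "pd i Q x = (\<Sum>j\<in>UNIV. V j x * pd i (V j) x) + pd i p x" for i x
  proof -
    have "pd i Q x = pd i (\<lambda>x. 1/2 * (\<Sum>j\<in>UNIV. V j x * V j x)) x + pd i p x"
      unfolding Q by (intro pd_add smooth_differentiable smooth_mult smooth_const smooth_sum sm)
    also have "pd i (\<lambda>x. 1/2 * (\<Sum>j\<in>UNIV. V j x * V j x)) x
        = 1/2 * pd i (\<lambda>x. \<Sum>j\<in>UNIV. V j x * V j x) x"
      by (subst pd_mult) (auto intro!: smooth_differentiable smooth_mult smooth_const smooth_sum sm)
    also have "pd i (\<lambda>x. \<Sum>j\<in>UNIV. V j x * V j x) x = (\<Sum>j\<in>UNIV. pd i (\<lambda>x. V j x * V j x) x)"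
      by (intro pd_sum smooth_differentiable smooth_mult sm)
    also have "\<dots> = (\<Sum>j\<in>UNIV. 2 * (V j x * pd i (V j) x))"
      by (intro sum.cong refl) (simp add: pd_mult df)
    finally show ?thesis by (simp flip: sum_distrib_left)
  qed
  have pd2Q: "pd i (pd i Q) x =
      (\<Sum>j\<in>UNIV. V j x * pd i (pd i (V j)) x + (pd i (V j) x)\<^sup>2) + pd i (pd i p) x" for i
  proof -
    have "pd i (pd i Q) x = pd i (\<lambda>x. (\<Sum>j\<in>UNIV. V j x * pd i (V j) x) + pd i p x) x"
      by (simp add: pdQ[abs_def])
    also have "\<dots> = pd i (\<lambda>x. \<Sum>j\<in>UNIV. V j x * pd i (V j) x) x + pd i (pd i p) x"
      by (intro pd_add smooth_differentiable smooth_mult smooth_sum sm)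
    also have "pd i (\<lambda>x. \<Sum>j\<in>UNIV. V j x * pd i (V j) x) x
        = (\<Sum>j\<in>UNIV. pd i (\<lambda>x. V j x * pd i (V j) x) x)"
      by (intro pd_sum smooth_differentiable smooth_mult sm)
    also have "\<dots> = (\<Sum>j\<in>UNIV. V j x * pd i (pd i (V j)) x + (pd i (V j) x)\<^sup>2)"
      by (intro sum.cong refl) (simp add: pd_mult df power2_eq_square)
    finally show ?thesis .
  qed
  have pd2p: "pd j (pd j p) x = (\<Sum>i\<in>UNIV. pd j (pd i (pd i (V j))) x)
      - (\<Sum>i\<in>UNIV. V i x * pd j (pd i (V j)) x + pd j (V i) x * pd i (V j) x)" for j
  proof -
    have "pd j (pd j p) x = pd j (\<lambda>x. (\<Sum>i\<in>UNIV. pd i (pd i (V j)) x) - (\<Sum>i\<in>UNIV. V i x * pd i (V j) x)) x"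
      by (simp add: momentum[abs_def])
    also have "\<dots> = pd j (\<lambda>x. \<Sum>i\<in>UNIV. pd i (pd i (V j)) x) x - pd j (\<lambda>x. \<Sum>i\<in>UNIV. V i x * pd i (V j) x) x"
      by (intro pd_diff smooth_differentiable smooth_mult smooth_sum sm)
    also have "pd j (\<lambda>x. \<Sum>i\<in>UNIV. pd i (pd i (V j)) x) x = (\<Sum>i\<in>UNIV. pd j (pd i (pd i (V j))) x)"
      by (intro pd_sum df)
    also have "pd j (\<lambda>x. \<Sum>i\<in>UNIV. V i x * pd i (V j) x) x = (\<Sum>i\<in>UNIV. pd j (\<lambda>x. V i x * pd i (V j) x) x)"
      by (intro pd_sum smooth_differentiable smooth_mult sm)
    also have "\<dots> = (\<Sum>i\<in>UNIV. V i x * pd j (pd i (V j)) x + pd j (V i) x * pd i (V j) x)"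
      by (intro sum.cong refl) (simp add: pd_mult df)
    finally show ?thesis .
  qed
  have c1: "pd j (pd i (V k)) = pd i (pd j (V k))" for i j k
    by (intro ext pd_commute V)
  have c2: "pd j (pd i (pd i (V j))) x = pd i (pd i (pd j (V j))) x" for i j
    using pd_commute[OF smooth_pd[OF V], of j i] by (simp add: c1)
  have "(\<Sum>j\<in>UNIV. \<Sum>i\<in>UNIV. pd j (pd i (pd i (V j))) x) = (\<Sum>j\<in>UNIV. \<Sum>i\<in>UNIV. pd i (pd i (pd j (V j))) x)"
    by (intro sum.cong refl c2)
  also have "\<dots> = (\<Sum>i\<in>UNIV. \<Sum>j\<in>UNIV. pd i (pd i (pd j (V j))) x)"
    by (rule sum.swap)
  finally have "(\<Sum>j\<in>UNIV. \<Sum>i\<in>UNIV. pd j (pd i (pd i (V j))) x) = 0"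
    by (simp add: div2)
  \<comment> \<open>After exchanging sums and derivatives this is the derivative of the divergence
    along \<open>v\<close>.\<close>
  moreover have "(\<Sum>j\<in>UNIV. \<Sum>i\<in>UNIV. V i x * pd j (pd i (V j)) x) = 0"
    by (subst sum.swap, subst c1) (simp add: div1 flip: sum_distrib_left)
  ultimately have lap_p: "(\<Sum>j\<in>UNIV. pd j (pd j p) x) = - (\<Sum>j\<in>UNIV. \<Sum>i\<in>UNIV. pd j (V i) x * pd i (V j) x)"
    unfolding pd2p by (simp add: sum_subtractf sum.distrib)
  \<comment> \<open>The cubic term from half the squared speed cancels against the convection term
    hidden in the pressure gradient.\<close>
  have "(\<Sum>i\<in>UNIV. v x $ i * pd i Q x)
      = (\<Sum>i\<in>UNIV. \<Sum>j\<in>UNIV. V i x * (V j x * pd i (V j) x)) + (\<Sum>j\<in>UNIV. V j x * pd j p x)"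
    by (simp add: pdQ V_def sum.distrib sum_distrib_left algebra_simps)
  also have "(\<Sum>i\<in>UNIV. \<Sum>j\<in>UNIV. V i x * (V j x * pd i (V j) x))
      = (\<Sum>j\<in>UNIV. V j x * (\<Sum>i\<in>UNIV. V i x * pd i (V j) x))"
    by (subst sum.swap) (simp add: sum_distrib_left algebra_simps)
  finally have vQ: "(\<Sum>i\<in>UNIV. v x $ i * pd i Q x) = (\<Sum>j\<in>UNIV. V j x * (\<Sum>i\<in>UNIV. pd i (pd i (V j)) x))"
    by (simp add: momentum algebra_simps flip: sum.distrib)
  have "(\<Sum>i\<in>UNIV. \<Sum>j\<in>UNIV. V j x * pd i (pd i (V j)) x) = (\<Sum>j\<in>UNIV. V j x * (\<Sum>i\<in>UNIV. pd i (pd i (V j)) x))"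
    by (subst sum.swap) (simp add: sum_distrib_left)
  then have "(\<Sum>i\<in>UNIV. pd i (pd i Q) x) - (\<Sum>i\<in>UNIV. v x $ i * pd i Q x)
      = (\<Sum>i\<in>UNIV. \<Sum>j\<in>UNIV. (pd i (V j) x)\<^sup>2) - (\<Sum>j\<in>UNIV. \<Sum>i\<in>UNIV. pd j (V i) x * pd i (V j) x)"
    unfolding vQ pd2Q by (simp add: sum.distrib lap_p)
  also have "(\<Sum>j\<in>UNIV. \<Sum>i\<in>UNIV. pd j (V i) x * pd i (V j) x) = (\<Sum>i\<in>UNIV. \<Sum>j\<in>UNIV. pd j (V i) x * pd i (V j) x)"
    by (rule sum.swap)
  finally show ?thesis
    by (simp add: norm_curl_squared sum_subtractf flip: V_def)
qed

section \<open>A Liouville property of fields without curl and divergence\<close>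

text \<open>Zero curl makes the Jacobian symmetric, so the Laplacian of each component is a
  derivative of the divergence, hence 0. The maximum principle without drift applies to the
  component and to its negative.\<close>

lemma irrotational_solenoidal_zero:
  assumes v: "smooth v" and div: "\<And>x. div_field v x = 0" and curl: "\<And>x. curl v x = 0"
    and lim: "(v \<longlongrightarrow> 0) at_infinity"
  shows "v x = 0"
proof -
  define V where "V j = (\<lambda>y. v y $ j)" for j
  have V: "smooth (V j)" for j unfolding V_def by (rule smooth_vec_nth[OF v])
  have sym: "pd i (V j) = pd j (V i)" for i j
  proof
    fix x
    have "curl v x $ 1 = 0" "curl v x $ 2 = 0" "curl v x $ 3 = 0"
      using curl by simp_all
    then have "pd 2 (V 3) x = pd 3 (V 2) x" "pd 3 (V 1) x = pd 1 (V 3) x" "pd 1 (V 2) x = pd 2 (V 1) x"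
      by (simp_all add: curl_def V_def)
    then show "pd i (V j) x = pd j (V i) x"
      using exhaust_3[of i] exhaust_3[of j] by auto
  qed
  have div0: "(\<Sum>i\<in>UNIV. pd i (V i) x) = 0" for x
    using div by (simp add: div_field_def V_def)
  have harm: "(\<Sum>i\<in>UNIV. pd i (pd i (V j)) x) = 0" for j x
  proof -
    have "(\<Sum>i\<in>UNIV. pd i (pd i (V j)) x) = (\<Sum>i\<in>UNIV. pd j (pd i (V i)) x)"
      by (subst sym, subst pd_commute[OF V]) simp
    also have "\<dots> = pd j (\<lambda>x. \<Sum>i\<in>UNIV. pd i (V i) x) x"
      by (intro pd_sum[symmetric] smooth_differentiable smooth_pd V)
    finally show ?thesis by (simp add: div0)
  qed
  have pm: "pd i (\<lambda>x. - V j x) = (\<lambda>x. - pd i (V j) x)" "pd i (\<lambda>x. - pd i (V j) x) x = - pd i (pd i (V j)) x" for i j x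
    by (auto simp: fun_eq_iff intro!: pd_minus smooth_differentiable smooth_pd V)
  have lim0: "(V j \<longlongrightarrow> 0) at_infinity" for j
    using tendsto_vec_nth[OF lim, of j] by (simp add: V_def)
  have div_0: "div_field (\<lambda>x. 0) x = 0" for x
    by (simp add: div_field_def)
  have "V j x \<le> 0" for j
    using subsolution_nonpos[OF V smooth_const[of 0] div_0 _ _ lim0, of j "\<lambda>x. 0"] by (simp add: harm)
  moreover have "- V j x \<le> 0" for j
    using subsolution_nonpos[OF smooth_minus[OF V] smooth_const[of 0] div_0 _ _ tendsto_minus[OF lim0, simplified], of j "\<lambda>x. 0"]
    by (simp add: harm pm sum_negf)
  ultimately show ?thesis
    by (simp add: vec_eq_iff V_def order_antisym)
qed

section \<open>The logarithmic weight\<close>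

text \<open>A real supremum is meaningful only for a set bounded above; this is what allows
  |\<open>Q x\<close>| to be compared with \<open>M\<close>.\<close>

lemma tendsto_0_at_infinity_bounded:
  fixes u :: "'a::euclidean_space \<Rightarrow> real"
  assumes "continuous_on UNIV u" "(u \<longlongrightarrow> 0) at_infinity"
  shows "bdd_above (range (\<lambda>x. \<bar>u x\<bar>))"
proof -
  have "eventually (\<lambda>x. dist (u x) 0 < 1) at_infinity"
    using assms(2) by (rule tendstoD) simp
  then obtain R where R: "\<And>x. norm x \<ge> R \<Longrightarrow> \<bar>u x\<bar> < 1"
    by (auto simp: eventually_at_infinity)
  have "bounded (u ` cball 0 R)"
    using assms(1) by (intro compact_imp_bounded compact_continuous_image) (auto intro: continuous_on_subset)
  then obtain C where C: "\<forall>y\<in>u ` cball 0 R. norm y \<le> C"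
    unfolding bounded_iff by blast
  have "\<bar>u x\<bar> \<le> max C 1" for x
    using R[of x] C by (cases "norm x \<le> R") (auto simp: le_max_iff_disj)
  then show ?thesis by (intro bdd_aboveI[of _ "max C 1"]) auto
qed

text \<open>\<open>soft_cut d l\<close> approximates \<open>l\<close> from below by a \<open>C\<^sup>1\<close> function vanishing for \<open>l \<le> d\<close>, with
  derivative \<open>1 - (d / max d l)\<^sup>2\<close> increasing to 1 as \<open>d\<close> decreases to 0.\<close>

definition soft_cut :: "real \<Rightarrow> real \<Rightarrow> real" where
  "soft_cut d l = (max d l - d)\<^sup>2 / max d l"

definition soft_cut_deriv :: "real \<Rightarrow> real \<Rightarrow> real" where
  "soft_cut_deriv d l = 1 - (d / max d l)\<^sup>2"

text \<open>For \<open>l\<close> at least \<open>d\<close> the function is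
  \<open>l - 2 * d + d^2 / l\<close>, whose slope vanishes at \<open>l = d\<close>, so it joins the
  constant 0 smoothly to first order.\<close>

lemma DERIV_soft_cut:
  assumes "d > 0"
  shows "(soft_cut d has_real_derivative soft_cut_deriv d l) (at l)"
  unfolding soft_cut_def[abs_def] soft_cut_deriv_def
proof (rule DERIV_max_const[where f = "\<lambda>m. (m - d)\<^sup>2 / m" and f' = "\<lambda>m. 1 - (d / m)\<^sup>2"])
  fix l assume "d \<le> l"
  with assms have "l \<noteq> 0" by simp
  then show "((\<lambda>m. (m - d)\<^sup>2 / m) has_real_derivative 1 - (d / l)\<^sup>2) (at l)"
    by (auto intro!: derivative_eq_intros simp: field_simps power2_eq_square)
qed (use assms in simp)

lemma isCont_soft_cut_deriv: "d > 0 \<Longrightarrow> isCont (soft_cut_deriv d) l"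
  unfolding soft_cut_deriv_def[abs_def] by (intro continuous_intros) auto

lemma soft_cut_nonneg: "d > 0 \<Longrightarrow> 0 \<le> soft_cut d l"
  by (simp add: soft_cut_def)

lemma soft_cut_deriv_nonneg: "d > 0 \<Longrightarrow> 0 \<le> soft_cut_deriv d l"
  by (simp add: soft_cut_deriv_def power_le_one)

lemma soft_cut_zero: "l \<le> d \<Longrightarrow> soft_cut d l = 0"
  by (simp add: soft_cut_def)

lemma soft_cut_deriv_zero: "0 < d \<Longrightarrow> l \<le> d \<Longrightarrow> soft_cut_deriv d l = 0"
  by (simp add: soft_cut_deriv_def)

text \<open>This and the analogous fact for the derivative provide the increasing sequences for
  monotone convergence as \<open>d\<close> decreases to 0.\<close>

lemma soft_cut_antimono:
  assumes "0 < d'" "d' \<le> d"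
  shows "soft_cut d l \<le> soft_cut d' l"
proof (cases "l \<le> d")
  case True
  then show ?thesis using assms soft_cut_nonneg[of d' l] by (simp add: soft_cut_zero)
next
  case False
  then have "(l - d)\<^sup>2 / l \<le> (l - d')\<^sup>2 / l"
    using assms by (intro divide_right_mono power_mono) auto
  then show ?thesis using False assms by (simp add: soft_cut_def max_def)
qed

lemma soft_cut_deriv_antimono:
  assumes "0 < d'" "d' \<le> d"
  shows "soft_cut_deriv d l \<le> soft_cut_deriv d' l"
proof -
  have "d' * max d l \<le> d * max d' l"
    using assms by (auto simp: max_def mult.commute)
  then have "d' / max d' l \<le> d / max d l"
    using assms by (simp add: divide_simps max_def split: if_splits)
  then have "(d' / max d' l)\<^sup>2 \<le> (d / max d l)\<^sup>2"
    using assms by (intro power_mono) auto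
  then show ?thesis by (simp add: soft_cut_deriv_def)
qed

lemma soft_cut_tendsto:
  assumes "0 \<le> l" "d \<longlonglongrightarrow> 0" "\<And>n. d n > 0"
  shows "(\<lambda>n. soft_cut (d n) l) \<longlonglongrightarrow> l"
proof (cases "l = 0")
  case True
  then show ?thesis using assms(3) by (simp add: soft_cut_zero less_imp_le)
next
  case False
  then have "(\<lambda>n. soft_cut (d n) l) \<longlonglongrightarrow> (max 0 l - 0)\<^sup>2 / max 0 l"
    unfolding soft_cut_def using assms by (intro tendsto_intros) auto
  with False assms(1) show ?thesis by (simp add: power2_eq_square)
qed

text \<open>Strict positivity of \<open>l\<close> matters: at \<open>l = 0\<close> the value is 0
  for every positive \<open>d\<close>.\<close>

lemma soft_cut_deriv_tendsto:
  assumes "0 < l" "d \<longlonglongrightarrow> 0"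
  shows "(\<lambda>n. soft_cut_deriv (d n) l) \<longlonglongrightarrow> 1"
proof -
  have "(\<lambda>n. soft_cut_deriv (d n) l) \<longlonglongrightarrow> 1 - (0 / max 0 l)\<^sup>2"
    unfolding soft_cut_deriv_def using assms by (intro tendsto_intros) auto
  then show ?thesis by simp
qed

lemma nn_integral_LIMSEQ_incseq:
  assumes "\<And>n. f n \<in> borel_measurable M" "\<And>x. incseq (\<lambda>n. f n x)"
    and "\<And>x. (\<lambda>n. f n x) \<longlonglongrightarrow> (g x :: ennreal)"
  shows "(\<lambda>n. \<integral>\<^sup>+ x. f n x \<partial>M) \<longlonglongrightarrow> (\<integral>\<^sup>+ x. g x \<partial>M)"
  using assms by (intro nn_integral_LIMSEQ) (auto simp: incseq_def le_fun_def)

text \<open>At zeros of \<open>Q\<close> both integrands vanish through \<open>x / 0 = 0\<close>, \<open>ln 0 = 0\<close> and \<open>0 powr a = 0\<close>.\<close>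

lemma weighted_integral_eq:
  assumes Q: "smooth Q" and v: "smooth v" and div_free: "\<And>x. div_field v x = 0"
    and eq: "\<And>x. (\<Sum>i\<in>UNIV. pd i (pd i Q) x) - (\<Sum>i\<in>UNIV. v x $ i * pd i Q x) = w x"
    and w: "\<And>x. 0 \<le> w x"
    and lim: "(Q \<longlongrightarrow> 0) at_infinity"
    and "\<alpha> > 0"
  shows "ennreal \<alpha> * weighted_integral Q \<alpha> =
    (\<integral>\<^sup>+ x. ennreal (ln (exp 1 * (SUP x. \<bar>Q x\<bar>) / \<bar>Q x\<bar>) powr (- \<alpha>) * w x) \<partial>lborel)"
proof -
  define M where "M = (SUP x. \<bar>Q x\<bar>)"
  define c where "c = exp 1 * M"
  have nonpos: "Q x \<le> 0" for x
    using Q v div_free eq w lim by (rule subsolution_nonpos)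
  have QM: "\<bar>Q x\<bar> \<le> M" for x
    unfolding M_def
    using tendsto_0_at_infinity_bounded[OF smooth_continuous_on[OF Q] lim] by (intro cSUP_upper) auto
  show ?thesis
  proof (cases "M = 0")
    case True
    then have "Q x = 0" for x using QM[of x] by simp
    then show ?thesis by (simp add: weighted_integral_def)
  next
    case False
    then have "M > 0" using QM[of 0] by linarith
    then have c: "c > 0" "M < c" by (auto simp: c_def)
    \<comment> \<open>As functions of \<open>s\<close> = |\<open>Q\<close>|, \<open>L\<close> is the
      limiting weight on the source \<open>w\<close>, and its derivative \<open>L'\<close> is
      \<alpha> times the weight on the squared gradient. Both are regular on
      \<open>0 < s < c\<close>, and \<open>M < c\<close> leaves room at the upper end.\<close>
    define L where "L s = ln (c / s) powr (- \<alpha>)" for s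
    define L' where "L' s = \<alpha> * (ln (c / s) powr (- \<alpha> - 1) / s)" for s
    have ln_pos: "ln (c / s) > 0" if "0 < s" "s < c" for s
      using that by (intro ln_gt_zero) simp
    have DL: "(L has_real_derivative L' s) (at s)" if "0 < s" "s < c" for s
      unfolding L_def L'_def using ln_pos[OF that] that
      by (auto intro!: derivative_eq_intros simp: field_simps)
    have CL': "isCont L' s" if "0 < s" "s < c" for s
      unfolding L'_def using ln_pos[OF that] that by (auto intro!: continuous_intros)
    \<comment> \<open>The threshold solves \<open>L s = d\<close>, that is
      \<open>ln (c / s) = d powr (- 1 / \<alpha>)\<close>. Below it \<open>soft_cut d\<close>
      annihilates \<open>L\<close>, so the test function vanishes near 0.\<close>
    have L_small: "\<exists>e>0. \<forall>s. 0 < s \<and> s < e \<longrightarrow> L s \<le> d" if "d > 0" for d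
    proof (intro exI[of _ "c * exp (- (d powr (- 1 / \<alpha>)))"] conjI allI impI)
      fix s assume s: "0 < s \<and> s < c * exp (- (d powr (- 1 / \<alpha>)))"
      then have "ln s < ln (c * exp (- (d powr (- 1 / \<alpha>))))"
        by (subst ln_less_cancel_iff) (auto simp: c)
      then have "d powr (- 1 / \<alpha>) \<le> ln (c / s)"
        using s c by (simp add: ln_mult ln_div)
      then have "L s \<le> (d powr (- 1 / \<alpha>)) powr (- \<alpha>)"
        unfolding L_def using \<open>\<alpha> > 0\<close> that by (intro powr_mono2') auto
      also have "\<dots> = d" using \<open>\<alpha> > 0\<close> that by (simp add: powr_powr)
      finally show "L s \<le> d" .
    qed (use c in simp)
    have Qlt: "\<bar>Q x\<bar> < c" for x using QM[of x] c by simp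
    have identity: "(\<integral>\<^sup>+ x. ennreal (soft_cut_deriv d (L \<bar>Q x\<bar>) * L' \<bar>Q x\<bar> * (norm (grad Q x))\<^sup>2) \<partial>lborel)
        = (\<integral>\<^sup>+ x. ennreal (soft_cut d (L \<bar>Q x\<bar>) * w x) \<partial>lborel)" if "d > 0" for d
    proof -
      obtain e where e: "e > 0" "\<And>s. 0 < s \<Longrightarrow> s < e \<Longrightarrow> L s \<le> d"
        using L_small[OF \<open>d > 0\<close>] by blast
      \<comment> \<open>Since \<open>Q\<close> is nonpositive, |\<open>Q\<close>| is
        \<open>- Q\<close> and the weight is placed on the negative axis. Extension by 0 remains
        continuously differentiable because the cut already vanishes near 0.\<close>
      define \<phi> where "\<phi> t = (if t < 0 then soft_cut d (L (- t)) else 0)" for t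
      define \<phi>' where "\<phi>' t = (if t < 0 then - (soft_cut_deriv d (L (- t)) * L' (- t)) else 0)" for t
      have zero: "\<phi> t = 0" "\<phi>' t = 0" if "- e < t" for t
        using e(2)[of "- t"] that \<open>d > 0\<close>
        by (auto simp: \<phi>_def \<phi>'_def soft_cut_zero soft_cut_deriv_zero)
      have deriv: "(\<phi> has_real_derivative \<phi>' t) (at t)" if "ereal (- c) < ereal t" for t
      proof (cases "t < 0")
        case True
        have "((\<lambda>t. L (- t)) has_real_derivative - L' (- t)) (at t)"
          using DERIV_chain2[where f = L and g = uminus and x = t, OF DL DERIV_minus[OF DERIV_ident]] True that
          by simp
        from DERIV_chain2[where f = "soft_cut d", OF DERIV_soft_cut[OF \<open>d > 0\<close>] this]
        have "((\<lambda>t. soft_cut d (L (- t))) has_real_derivative \<phi>' t) (at t)"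
          using True by (simp add: \<phi>'_def)
        then show ?thesis
          by (rule has_field_derivative_transform_within_open[where S = "{..<0}"])
            (use True in \<open>auto simp: \<phi>_def\<close>)
      next
        case False
        have "((\<lambda>t. 0) has_real_derivative \<phi>' t) (at t)"
          using False by (simp add: \<phi>'_def)
        then show ?thesis
          by (rule has_field_derivative_transform_within_open[where S = "{-e<..}"])
            (use False e zero in auto)
      qed
      have contd: "isCont \<phi>' t" if "ereal (- c) < ereal t" for t
      proof (cases "t < 0")
        case True
        have 1: "isCont uminus t" by (intro continuous_intros)
        have 2: "isCont (\<lambda>t. L' (- t)) t"
          using True that by (intro isCont_o2[OF 1] CL') auto
        have 3: "isCont (\<lambda>t. L (- t)) t"
          using True that by (intro isCont_o2[OF 1] DERIV_isCont[OF DL]) auto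
        have "isCont (\<lambda>t. - (soft_cut_deriv d (L (- t)) * L' (- t))) t"
          by (intro continuous_intros 2 isCont_o2[OF 3] isCont_soft_cut_deriv \<open>d > 0\<close>)
        moreover have "eventually (\<lambda>s. s \<in> {..<0}) (nhds t)"
          using True by (intro eventually_nhds_in_open) auto
        then have "eventually (\<lambda>s. - (soft_cut_deriv d (L (- s)) * L' (- s)) = \<phi>' s) (nhds t)"
          by eventually_elim (simp add: \<phi>'_def)
        note isCont_cong[OF this]
        ultimately show ?thesis by simp
      next
        case False
        have "eventually (\<lambda>s. s \<in> {-e<..}) (nhds t)"
          using False e by (intro eventually_nhds_in_open) auto
        then have "eventually (\<lambda>s. \<phi>' s = 0) (nhds t)"
          by eventually_elim (simp add: zero)
        then show ?thesis using isCont_cong[of \<phi>' "\<lambda>s. 0"] by auto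
      qed
      have range: "ereal (- c) < ereal (Q x)" "ereal (Q x) < \<infinity>" for x
        using Qlt[of x] by auto
      note E = energy_identity[OF Q v div_free eq lim range _ _ deriv contd e(1)]
      have phi: "\<phi> (Q x) = soft_cut d (L \<bar>Q x\<bar>)" for x
        using nonpos[of x] \<open>d > 0\<close> by (auto simp: \<phi>_def L_def soft_cut_zero)
      have phi': "\<phi>' (Q x) = - (soft_cut_deriv d (L \<bar>Q x\<bar>) * L' \<bar>Q x\<bar>)" for x
        using nonpos[of x] by (auto simp: \<phi>'_def L'_def)
      have L'_nonneg: "0 \<le> L' \<bar>Q x\<bar>" for x
        using \<open>\<alpha> > 0\<close> by (simp add: L'_def)
      have E1: "integrable lborel (\<lambda>x. \<phi>' (Q x) * (norm (grad Q x))\<^sup>2)"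
        using c by (intro E(1)) (auto simp: zero)
      have E2: "integrable lborel (\<lambda>x. \<phi> (Q x) * w x)"
        using c by (intro E(2)) (auto simp: zero)
      have E3: "(\<integral>x. \<phi> (Q x) * w x \<partial>lborel) = - (\<integral>x. \<phi>' (Q x) * (norm (grad Q x))\<^sup>2 \<partial>lborel)"
        using c by (intro E(3)) (auto simp: zero)
      have "(\<integral>\<^sup>+ x. ennreal (soft_cut_deriv d (L \<bar>Q x\<bar>) * L' \<bar>Q x\<bar> * (norm (grad Q x))\<^sup>2) \<partial>lborel)
          = (\<integral>\<^sup>+ x. ennreal (- (\<phi>' (Q x) * (norm (grad Q x))\<^sup>2)) \<partial>lborel)"
        by (simp add: phi')
      also have "\<dots> = ennreal (\<integral>x. - (\<phi>' (Q x) * (norm (grad Q x))\<^sup>2) \<partial>lborel)"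
        using E1 soft_cut_deriv_nonneg[OF \<open>d > 0\<close>] L'_nonneg
        by (intro nn_integral_eq_integral) (auto simp: phi')
      also have "\<dots> = ennreal (\<integral>x. \<phi> (Q x) * w x \<partial>lborel)"
        using E1 E3 by simp
      also have "\<dots> = (\<integral>\<^sup>+ x. ennreal (\<phi> (Q x) * w x) \<partial>lborel)"
        using E2 soft_cut_nonneg[OF \<open>d > 0\<close>] w
        by (intro nn_integral_eq_integral[symmetric]) (auto simp: phi)
      finally show ?thesis by (simp add: phi)
    qed
    have [measurable]: "Q \<in> borel_measurable borel"
      by (intro borel_measurable_continuous_onI smooth_continuous_on Q)
    have [measurable]: "(\<lambda>x. (norm (grad Q x))\<^sup>2) \<in> borel_measurable borel"
      unfolding norm_grad_squared
      by (intro borel_measurable_continuous_onI continuous_intros smooth_continuous_on smooth_pd Q)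
    have [measurable]: "w \<in> borel_measurable borel"
      unfolding eq[symmetric, abs_def]
      by (intro borel_measurable_continuous_onI continuous_intros smooth_continuous_on smooth_pd Q smooth_vec_nth v)
    have [measurable]: "L \<in> borel_measurable borel" "L' \<in> borel_measurable borel"
      unfolding L_def[abs_def] L'_def[abs_def] by measurable
    have [measurable]: "soft_cut d \<in> borel_measurable borel" "soft_cut_deriv d \<in> borel_measurable borel" for d
      unfolding soft_cut_def[abs_def] soft_cut_deriv_def[abs_def] by measurable
    define d where "d n = 1 / real (Suc n)" for n
    have d: "d n > 0" for n by (simp add: d_def)
    have d_anti: "m \<le> n \<Longrightarrow> d n \<le> d m" for m n by (simp add: d_def frac_le)
    have d_lim: "d \<longlonglongrightarrow> 0"
      unfolding d_def[abs_def] using LIMSEQ_inverse_real_of_nat by (simp add: inverse_eq_divide)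
    have L'_nonneg: "0 \<le> L' \<bar>Q x\<bar>" for x
      using \<open>\<alpha> > 0\<close> by (simp add: L'_def)
    \<comment> \<open>The cut is removed on both sides by monotone convergence in extended
      nonnegative integrals, so no finiteness of the limits is needed.\<close>
    have "(\<lambda>n. \<integral>\<^sup>+ x. ennreal (soft_cut_deriv (d n) (L \<bar>Q x\<bar>) * L' \<bar>Q x\<bar> * (norm (grad Q x))\<^sup>2) \<partial>lborel)
        \<longlonglongrightarrow> (\<integral>\<^sup>+ x. ennreal (L' \<bar>Q x\<bar> * (norm (grad Q x))\<^sup>2) \<partial>lborel)"
    proof (rule nn_integral_LIMSEQ_incseq)
      fix x
      show "incseq (\<lambda>n. ennreal (soft_cut_deriv (d n) (L \<bar>Q x\<bar>) * L' \<bar>Q x\<bar> * (norm (grad Q x))\<^sup>2))"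
        using soft_cut_deriv_antimono[OF d d_anti] L'_nonneg
        by (intro incseq_SucI ennreal_leI mult_right_mono) auto
      show "(\<lambda>n. ennreal (soft_cut_deriv (d n) (L \<bar>Q x\<bar>) * L' \<bar>Q x\<bar> * (norm (grad Q x))\<^sup>2))
          \<longlonglongrightarrow> ennreal (L' \<bar>Q x\<bar> * (norm (grad Q x))\<^sup>2)"
      proof (cases "Q x = 0")
        case True
        then show ?thesis by (simp add: L'_def)
      next
        case False
        then have "L \<bar>Q x\<bar> > 0" using ln_pos[of "\<bar>Q x\<bar>"] Qlt[of x] by (simp add: L_def)
        then have "(\<lambda>n. soft_cut_deriv (d n) (L \<bar>Q x\<bar>) * L' \<bar>Q x\<bar> * (norm (grad Q x))\<^sup>2)
          \<longlonglongrightarrow> 1 * L' \<bar>Q x\<bar> * (norm (grad Q x))\<^sup>2"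
          by (intro tendsto_intros soft_cut_deriv_tendsto d_lim)
        then show ?thesis by (intro tendsto_ennrealI) simp
      qed
    qed measurable
    moreover have "(\<lambda>n. \<integral>\<^sup>+ x. ennreal (soft_cut (d n) (L \<bar>Q x\<bar>) * w x) \<partial>lborel)
        \<longlonglongrightarrow> (\<integral>\<^sup>+ x. ennreal (L \<bar>Q x\<bar> * w x) \<partial>lborel)"
    proof (rule nn_integral_LIMSEQ_incseq)
      fix x
      show "incseq (\<lambda>n. ennreal (soft_cut (d n) (L \<bar>Q x\<bar>) * w x))"
        using soft_cut_antimono[OF d d_anti] w
        by (intro incseq_SucI ennreal_leI mult_right_mono) auto
      show "(\<lambda>n. ennreal (soft_cut (d n) (L \<bar>Q x\<bar>) * w x)) \<longlonglongrightarrow> ennreal (L \<bar>Q x\<bar> * w x)"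
        by (intro tendsto_ennrealI tendsto_intros soft_cut_tendsto d_lim d) (simp add: L_def)
    qed measurable
    ultimately have limits: "(\<integral>\<^sup>+ x. ennreal (L' \<bar>Q x\<bar> * (norm (grad Q x))\<^sup>2) \<partial>lborel)
        = (\<integral>\<^sup>+ x. ennreal (L \<bar>Q x\<bar> * w x) \<partial>lborel)"
      unfolding identity[OF d] by (rule LIMSEQ_unique)
    have "ennreal \<alpha> * weighted_integral Q \<alpha> = (\<integral>\<^sup>+ x. ennreal \<alpha> *
        ennreal ((norm (grad Q x))\<^sup>2 / \<bar>Q x\<bar> * ln (c / \<bar>Q x\<bar>) powr (- \<alpha> - 1)) \<partial>lborel)"
      by (simp add: weighted_integral_def c_def M_def nn_integral_cmult)
    also have "\<dots> = (\<integral>\<^sup>+ x. ennreal (L' \<bar>Q x\<bar> * (norm (grad Q x))\<^sup>2) \<partial>lborel)"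
      using \<open>\<alpha> > 0\<close>
      by (intro nn_integral_cong) (simp add: L'_def ac_simps flip: ennreal_mult')
    finally show ?thesis
      by (simp add: limits L_def c_def M_def)
  qed
qed

section \<open>Vanishing of the vorticity and conclusion\<close>

text \<open>On the open set where \<open>w\<close> is nonzero, \<open>Q\<close> vanishes
  identically, and so do its first and second derivatives; the equation then forces \<open>w\<close>
  to be 0 there.\<close>

lemma subsolution_source_zero:
  assumes Q: "smooth Q" and w_cont: "continuous_on UNIV w"
    and eq: "\<And>x. (\<Sum>i\<in>UNIV. pd i (pd i Q) x) - (\<Sum>i\<in>UNIV. b x $ i * pd i Q x) = w x"
    and zero: "\<And>x. Q x \<noteq> 0 \<Longrightarrow> w x = 0"
  shows "w x = 0"
proof (rule ccontr)
  assume "w x \<noteq> 0"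
  define S where "S = {x. w x \<noteq> 0}"
  have S: "open S" "x \<in> S"
    using \<open>w x \<noteq> 0\<close> w_cont by (auto simp: S_def intro!: open_Collect_neq continuous_on_const)
  have "Q y = 0" if "y \<in> S" for y using that zero by (auto simp: S_def)
  then have pd0: "pd i Q y = 0" if "y \<in> S" for i y
    using pd_zero_on_open[OF S(1)] that by blast
  then have "pd i (pd i Q) x = 0" for i
    using pd_zero_on_open[OF S(1) _ S(2)] by blast
  with pd0[OF S(2)] eq[of x] \<open>w x \<noteq> 0\<close> show False by simp
qed

text \<open>The little-o condition concerns values in the extended reals. As \<open>enn2real\<close>
  sends infinity to 0, eventual finiteness is stated separately to express it faithfully.\<close>

theorem theorem1p2:
  fixes v :: "real^3 \<Rightarrow> real^3" and p :: "real^3 \<Rightarrow> real"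
  assumes "smooth_stationary_NS v p"
    and "(head_pressure v p \<longlongrightarrow> 0) at_infinity"
  shows "(\<forall>\<alpha>>0. weighted_integral (head_pressure v p) \<alpha>
            \<le> ennreal (1 / \<alpha>) * (\<integral>\<^sup>+ x. ennreal ((norm (curl v x))\<^sup>2) \<partial>lborel)) \<and>
         ((v \<longlongrightarrow> 0) at_infinity \<and>
          (\<forall>\<^sub>F \<alpha> in at_right 0. weighted_integral (head_pressure v p) \<alpha> < \<infinity>) \<and>
          (\<lambda>\<alpha>. enn2real (weighted_integral (head_pressure v p) \<alpha>)) \<in> o[at_right 0](\<lambda>\<alpha>. 1 / \<alpha>)
          \<longrightarrow> (\<forall>x. v x = 0))"
proof -
  define Q where "Q = head_pressure v p"
  define w where "w x = (norm (curl v x))\<^sup>2" for x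
  define l where "l x = ln (exp 1 * (SUP x. \<bar>Q x\<bar>) / \<bar>Q x\<bar>)" for x
  define W where "W = weighted_integral Q"
  have v: "smooth v" and p: "smooth p" and div: "\<And>x. div_field v x = 0"
    using assms(1) by (auto simp: smooth_stationary_NS_def)
  have Q: "smooth Q" unfolding Q_def by (rule smooth_head_pressure[OF v p])
  have lim: "(Q \<longlongrightarrow> 0) at_infinity" using assms(2) by (simp add: Q_def)
  have eq: "(\<Sum>i\<in>UNIV. pd i (pd i Q) x) - (\<Sum>i\<in>UNIV. v x $ i * pd i Q x) = w x" for x
    unfolding Q_def w_def by (rule head_pressure_equation[OF assms(1)])
  have w: "0 \<le> w x" for x by (simp add: w_def)
  have W: "ennreal \<alpha> * W \<alpha> = (\<integral>\<^sup>+ x. ennreal (l x powr (- \<alpha>) * w x) \<partial>lborel)" if "\<alpha> > 0" for \<alpha>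
    unfolding W_def l_def using weighted_integral_eq[OF Q v div eq w lim that] .
  have l: "1 \<le> l x" if "Q x \<noteq> 0" for x
  proof -
    have "\<bar>Q x\<bar> \<le> (SUP x. \<bar>Q x\<bar>)"
      using tendsto_0_at_infinity_bounded[OF smooth_continuous_on[OF Q] lim] by (intro cSUP_upper) auto
    then have "exp 1 \<le> exp 1 * (SUP x. \<bar>Q x\<bar>) / \<bar>Q x\<bar>"
      using that by (simp add: field_simps)
    then show ?thesis
      unfolding l_def by (subst ln_ge_iff) (auto intro: less_le_trans[OF exp_gt_zero])
  qed
  have l0: "l x = 0" if "Q x = 0" for x using that by (simp add: l_def)
  have part1: "W \<alpha> \<le> ennreal (1 / \<alpha>) * (\<integral>\<^sup>+ x. ennreal (w x) \<partial>lborel)" if "\<alpha> > 0" for \<alpha>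
  proof -
    \<comment> \<open>The logarithm is at least 1 where \<open>Q\<close> is nonzero; at zeros of
      \<open>Q\<close> the weight is 0 by convention.\<close>
    have "l x powr (- \<alpha>) \<le> 1" for x
    proof (cases "Q x = 0")
      case False
      then have "l x powr (- \<alpha>) \<le> l x powr 0"
        using l[of x] \<open>\<alpha> > 0\<close> by (intro powr_mono) auto
      with l[OF False] show ?thesis by simp
    qed (simp add: l0)
    then have "l x powr (- \<alpha>) * w x \<le> w x" for x
      using mult_right_mono[of _ 1, OF _ w] by simp
    then have "ennreal \<alpha> * W \<alpha> \<le> (\<integral>\<^sup>+ x. ennreal (w x) \<partial>lborel)"
      unfolding W[OF that] by (intro nn_integral_mono ennreal_leI)
    then have "ennreal (1 / \<alpha>) * (ennreal \<alpha> * W \<alpha>) \<le> ennreal (1 / \<alpha>) * (\<integral>\<^sup>+ x. ennreal (w x) \<partial>lborel)"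
      by (rule mult_left_mono) simp
    moreover have "ennreal (1 / \<alpha>) * (ennreal \<alpha> * W \<alpha>) = W \<alpha>"
      using that by (simp flip: mult.assoc ennreal_mult')
    ultimately show ?thesis by simp
  qed
  have part2: "v x = 0"
    if v_lim: "(v \<longlongrightarrow> 0) at_infinity" and fin: "\<forall>\<^sub>F \<alpha> in at_right 0. W \<alpha> < \<infinity>"
      and small: "(\<lambda>\<alpha>. enn2real (W \<alpha>)) \<in> o[at_right 0](\<lambda>\<alpha>. 1 / \<alpha>)" for x
  proof -
    \<comment> \<open>A fixed exponent 1 serves for comparison: for \<alpha> below 1 this integral
      is at most \<alpha> times \<open>W \<alpha>\<close>, which smallness brings below any
      \<open>e\<close>. One suitable \<alpha> for each \<open>e\<close> suffices.\<close>
    let ?I = "\<integral>\<^sup>+ x. ennreal (l x powr (- 1) * w x) \<partial>lborel"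
    have "?I \<le> 0"
    proof (rule ennreal_le_epsilon)
      fix e :: real assume "e > 0"
      have "\<forall>\<^sub>F \<alpha> in at_right 0. norm (enn2real (W \<alpha>)) \<le> e * norm (1 / \<alpha>)"
        using small \<open>e > 0\<close> by (rule landau_o.smallD)
      moreover have "\<forall>\<^sub>F \<alpha> in at_right (0::real). \<alpha> \<in> {0<..<1}"
        by (rule eventually_at_right_real) simp
      ultimately have "\<forall>\<^sub>F \<alpha> in at_right 0.
          W \<alpha> < \<infinity> \<and> norm (enn2real (W \<alpha>)) \<le> e * norm (1 / \<alpha>) \<and> \<alpha> \<in> {0<..<1}"
        using fin by (intro eventually_conj)
      then obtain \<alpha> where \<alpha>: "W \<alpha> < \<infinity>" "norm (enn2real (W \<alpha>)) \<le> e * norm (1 / \<alpha>)" "0 < \<alpha>" "\<alpha> < 1"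
        by (auto dest!: eventually_happens'[rotated])
      have "l x powr (- 1) \<le> l x powr (- \<alpha>)" for x
      proof (cases "Q x = 0")
        case False
        then show ?thesis using l[of x] \<alpha> by (intro powr_mono) auto
      qed (simp add: l0)
      then have "?I \<le> (\<integral>\<^sup>+ x. ennreal (l x powr (- \<alpha>) * w x) \<partial>lborel)"
        using w by (intro nn_integral_mono ennreal_leI mult_right_mono)
      \<comment> \<open>Finiteness of \<open>W \<alpha>\<close> is essential here, since otherwise
        \<open>enn2real\<close> would lose the value.\<close>
      also have "\<dots> = ennreal \<alpha> * ennreal (enn2real (W \<alpha>))"
        using W[OF \<alpha>(3)] \<alpha>(1) by simp
      also have "\<dots> = ennreal (\<alpha> * enn2real (W \<alpha>))"
        using \<alpha>(3) by (simp add: ennreal_mult')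
      also have "\<dots> \<le> ennreal e"
        using \<alpha> by (intro ennreal_leI) (simp add: field_simps)
      finally show "?I \<le> 0 + ennreal e" by simp
    qed
    have w_cont: "continuous_on UNIV w"
      unfolding eq[symmetric, abs_def]
      by (intro continuous_intros smooth_continuous_on smooth_pd Q smooth_vec_nth v)
    then have [measurable]: "w \<in> borel_measurable borel"
      by (rule borel_measurable_continuous_onI)
    have [measurable]: "Q \<in> borel_measurable borel"
      by (intro borel_measurable_continuous_onI smooth_continuous_on Q)
    have "(\<lambda>x. ennreal (l x powr (- 1) * w x)) \<in> borel_measurable lborel"
      unfolding l_def by measurable
    from nn_integral_0_iff_AE[OF this] \<open>?I \<le> 0\<close>
    have AE0: "AE x in lborel. l x powr (- 1) * w x \<le> 0" by (simp add: ennreal_eq_0_iff)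
    define S where "S = {x. Q x \<noteq> 0} \<inter> {x. w x \<noteq> 0}"
    have "open S"
      unfolding S_def using w_cont smooth_continuous_on[OF Q]
      by (intro open_Int open_Collect_neq continuous_on_const)
    moreover have "x \<notin> S" if "l x powr (- 1) * w x \<le> 0" for x
    proof
      assume "x \<in> S"
      then have "0 < l x powr (- 1)" "0 < w x"
        using l[of x] w[of x] by (auto simp: S_def less_le)
      then have "0 < l x powr (- 1) * w x" by (rule mult_pos_pos)
      with that show False by linarith
    qed
    then have "AE x in lborel. x \<notin> S"
      using AE0 by (auto elim!: eventually_mono)
    ultimately have "S = {}" by (rule open_AE_notin_imp_empty)
    then have "w x = 0" if "Q x \<noteq> 0" for x using that by (auto simp: S_def)
    \<comment> \<open>The weighted integral controls \<open>w\<close> only where \<open>Q\<close> is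
      nonzero; the zeros of \<open>Q\<close> are covered by the equation itself.\<close>
    from subsolution_source_zero[OF Q w_cont eq this]
    have "curl v x = 0" for x by (simp add: w_def)
    from irrotational_solenoidal_zero[OF v div this v_lim] show ?thesis .
  qed
  from part1 part2 show ?thesis
    unfolding Q_def W_def w_def by blast
qed

end
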